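(* Let $a_1,a_2\in\mathbb{R}$ with $a_2\neq0$. The potential symmetries of the Fokker-Planck equation $$u_t=-a_2u-(a_2x+a_1)u_x+\tfrac12u_{xx}$$ are generated by the vector fields $$Y_1=\frac{1}{2a_2}e^{-a_2t}\frac{\partial}{\partial x}+\Big[\Big(x+\frac{a_1}{a_2}\Big)u+v\Big]e^{-a_2t}\frac{\partial}{\partial u},$$ $$Y_2=-(a_2x+a_1)e^{-2a_2t}\frac{\partial}{\partial x}+e^{-2a_2t}\frac{\partial}{\partial t}-2\Big[\big((a_2x+a_1)^2-a_2\big)u+2a_2(a_2x+a_1)v\Big]e^{-2a_2t}\frac{\partial}{\partial u}.$$
   Context: The independent variables are $(x,t)$; subscripts denote partial derivatives, and all functions are smooth. The Fokker-Planck equation has the conserved form $D_tu+D_x\big((a_2x+a_1)u-\frac12u_x\big)=0$, where $D_x,D_t$ are the total derivatives. Introducing a potential $v(x,t)$ as a new dependent variable gives the auxiliary system $$v_t=-(a_2x+a_1)u+\tfrac12u_x,\qquad v_x=u.$$ Put $\Delta_1=v_t+(a_2x+a_1)u-\frac12u_x$ and $\Delta_2=v_x-u$, regarded as functions on the jet space. A vector field $W=\xi\frac{\partial}{\partial x}+\tau\frac{\partial}{\partial t}+\eta\frac{\partial}{\partial u}+\phi\frac{\partial}{\partial v}$, with $\xi,\tau,\eta,\phi$ functions of $(x,t,u,v)$, is a generator of point symmetries of the auxiliary system if its prolongation to the jet space annihilates $\Delta_1$ and $\Delta_2$ whenever $\Delta_1=\Delta_2=0$. Since $\Delta_1,\Delta_2$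 involve only first-order derivatives, only the following part of the prolongation matters: $$W+\eta^x\frac{\partial}{\partial u_x}+\eta^t\frac{\partial}{\partial u_t}+\phi^x\frac{\partial}{\partial v_x}+\phi^t\frac{\partial}{\partial v_t},$$ where $\eta^x=D_x\eta-u_xD_x\xi-u_tD_x\tau$, $\eta^t=D_t\eta-u_xD_t\xi-u_tD_t\tau$, $\phi^x=D_x\phi-v_xD_x\xi-v_tD_x\tau$, $\phi^t=D_t\phi-v_xD_t\xi-v_tD_t\tau$. Given such a generator $W$ of point symmetries of the auxiliary system, one says that the system defines a potential symmetry admitted by the Fokker-Planck equation if and only if at least one of $\xi,\tau,\eta$ depends explicitly on the potential $v$, that is, if and only if $$\Big(\frac{\partial\xi}{\partial v}\Big)^2+\Big(\frac{\partial\tau}{\partial v}\Big)^2+\Big(\frac{\partial\eta}{\partial v}\Big)^2\neq0.$$ In this case $Y=\xi\frac{\partial}{\partial x}+\tau\frac{\partial}{\partial t}+\eta\frac{\partial}{\partial u}$ is called a potential symmetry of the Fokker-Planck equation.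
   Formalization: "Generated by" is taken modulo symmetries with ξ, τ, η free of v: potential symmetries are exactly c1 Y1 + c2 Y2 + Y0, (c1,c2) ≠ (0,0), Y0 such a symmetry; literally, the span of Y1, Y2 misses the potential symmetry Y1 + u∂/∂u. *)

theory Defs
  imports "HOL-Analysis.Analysis"
begin

text \<open>
  The Fokker-Planck equation
  \<open>u\<^sub>t = - a2 u - (a2 x + a1) u\<^sub>x + u\<^sub>x\<^sub>x / 2\<close> is the conservation law
  \<open>D\<^sub>t u + D\<^sub>x ((a2 x + a1) u - u\<^sub>x / 2) = 0\<close>.  Its potential symmetries are, by definition, read
  off from the point symmetries of the auxiliary system
  \<open>v\<^sub>t = - (a2 x + a1) u + u\<^sub>x / 2\<close>, \<open>v\<^sub>x = u\<close> in the dependent variables \<open>u, v\<close>.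
\<close>

text \<open>Smooth (\<open>C\<^sup>\<infinity>\<close>) maps on an open set, by iterating partial derivatives.\<close>

primrec C_on :: "nat \<Rightarrow> ('a::euclidean_space \<Rightarrow> 'b::real_normed_vector) \<Rightarrow> 'a set \<Rightarrow> bool" where
  "C_on 0 f S \<longleftrightarrow> continuous_on S f"
| "C_on (Suc k) f S \<longleftrightarrow>
     (\<forall>x\<in>S. f differentiable (at x)) \<and>
     (\<forall>b\<in>Basis. C_on k (\<lambda>x. frechet_derivative f (at x) b) S)"

definition smooth_on :: "('a::euclidean_space \<Rightarrow> 'b::real_normed_vector) \<Rightarrow> 'a set \<Rightarrow> bool" where
  "smooth_on f S \<longleftrightarrow> (\<forall>k. C_on k f S)"

text \<open>
  Points are \<open>(x, t, u, v)\<close>.  The fibre coordinates of the first-order jet space are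
  \<open>(u\<^sub>x, u\<^sub>t, v\<^sub>x, v\<^sub>t)\<close>.
\<close>

type_synonym point = "real \<times> real \<times> real \<times> real"
type_synonym jet = "point \<times> real \<times> real \<times> real \<times> real"

definition pd_x :: "(point \<Rightarrow> real) \<Rightarrow> point \<Rightarrow> real" where
  "pd_x f p = frechet_derivative f (at p) (1, 0, 0, 0)"

definition pd_t :: "(point \<Rightarrow> real) \<Rightarrow> point \<Rightarrow> real" where
  "pd_t f p = frechet_derivative f (at p) (0, 1, 0, 0)"

definition pd_u :: "(point \<Rightarrow> real) \<Rightarrow> point \<Rightarrow> real" where
  "pd_u f p = frechet_derivative f (at p) (0, 0, 1, 0)"

definition pd_v :: "(point \<Rightarrow> real) \<Rightarrow> point \<Rightarrow> real" where
  "pd_v f p = frechet_derivative f (at p) (0, 0, 0, 1)"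

definition total_x :: "(point \<Rightarrow> real) \<Rightarrow> jet \<Rightarrow> real" where
  "total_x f = (\<lambda>(p, ux, ut, vx, vt). pd_x f p + ux * pd_u f p + vx * pd_v f p)"

definition total_t :: "(point \<Rightarrow> real) \<Rightarrow> jet \<Rightarrow> real" where
  "total_t f = (\<lambda>(p, ux, ut, vx, vt). pd_t f p + ut * pd_u f p + vt * pd_v f p)"

definition Delta1 :: "real \<Rightarrow> real \<Rightarrow> jet \<Rightarrow> real" where
  "Delta1 a1 a2 = (\<lambda>((x, t, u, v), ux, ut, vx, vt). vt + (a2 * x + a1) * u - ux / 2)"

definition Delta2 :: "jet \<Rightarrow> real" where
  "Delta2 = (\<lambda>((x, t, u, v), ux, ut, vx, vt). vx - u)"

text \<open>
  A vector field on \<open>(x, t, u, v)\<close>-space is the map sending a point to its coefficient vector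
  \<open>(\<xi>, \<tau>, \<eta>, \<phi>)\<close>; likewise its first prolongation, on the jet space.
\<close>

definition prolongation :: "(point \<Rightarrow> point) \<Rightarrow> jet \<Rightarrow> jet" where
  "prolongation W = (\<lambda>(p, ux, ut, vx, vt).
     let z = (p, ux, ut, vx, vt);
         \<xi> = (\<lambda>q. fst (W q));
         \<tau> = (\<lambda>q. fst (snd (W q)));
         \<eta> = (\<lambda>q. fst (snd (snd (W q))));
         \<phi> = (\<lambda>q. snd (snd (snd (W q))))
     in (W p,
         total_x \<eta> z - ux * total_x \<xi> z - ut * total_x \<tau> z,
         total_t \<eta> z - ux * total_t \<xi> z - ut * total_t \<tau> z,
         total_x \<phi> z - vx * total_x \<xi> z - vt * total_x \<tau> z,
         total_t \<phi> z - vx * total_t \<xi> z - vt * total_t \<tau> z))"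

definition apply_field :: "(jet \<Rightarrow> jet) \<Rightarrow> (jet \<Rightarrow> real) \<Rightarrow> jet \<Rightarrow> real" where
  "apply_field V F z = frechet_derivative F (at z) (V z)"

text \<open>The jet coordinates range over the whole fibre above the domain \<open>U\<close> of the field.\<close>

definition point_symmetry :: "real \<Rightarrow> real \<Rightarrow> point set \<Rightarrow> (point \<Rightarrow> point) \<Rightarrow> bool" where
  "point_symmetry a1 a2 U W \<longleftrightarrow>
     smooth_on W U \<and>
     (\<forall>z. fst z \<in> U \<and> Delta1 a1 a2 z = 0 \<and> Delta2 z = 0 \<longrightarrow>
          apply_field (prolongation W) (Delta1 a1 a2) z = 0 \<and>
          apply_field (prolongation W) Delta2 z = 0)"

text \<open>
  \<open>Y = (\<xi>, \<tau>, \<eta>)\<close> with coefficients depending on \<open>(x, t, u, v)\<close>.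
\<close>

type_synonym yfield = "point \<Rightarrow> real \<times> real \<times> real"

definition depends_on_v :: "point set \<Rightarrow> yfield \<Rightarrow> bool" where
  "depends_on_v U Y \<longleftrightarrow>
     (\<exists>p\<in>U. (pd_v (\<lambda>q. fst (Y q)) p)\<^sup>2 + (pd_v (\<lambda>q. fst (snd (Y q))) p)\<^sup>2
           + (pd_v (\<lambda>q. snd (snd (Y q))) p)\<^sup>2 \<noteq> 0)"

definition induced_symmetry :: "real \<Rightarrow> real \<Rightarrow> point set \<Rightarrow> yfield \<Rightarrow> bool" where
  "induced_symmetry a1 a2 U Y \<longleftrightarrow>
     (\<exists>\<phi>. point_symmetry a1 a2 U (\<lambda>p. (fst (Y p), fst (snd (Y p)), snd (snd (Y p)), \<phi> p)))"

definition potential_symmetry :: "real \<Rightarrow> real \<Rightarrow> point set \<Rightarrow> yfield \<Rightarrow> bool" where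
  "potential_symmetry a1 a2 U Y \<longleftrightarrow> induced_symmetry a1 a2 U Y \<and> depends_on_v U Y"

text \<open>
  The fields induced by point symmetries of the auxiliary system that are not potential symmetries;
  adding one of these to a potential symmetry gives a potential symmetry again.
\<close>

definition nonpotential_symmetry :: "real \<Rightarrow> real \<Rightarrow> point set \<Rightarrow> yfield \<Rightarrow> bool" where
  "nonpotential_symmetry a1 a2 U Y \<longleftrightarrow> induced_symmetry a1 a2 U Y \<and> \<not> depends_on_v U Y"

definition Y1 :: "real \<Rightarrow> real \<Rightarrow> yfield" where
  "Y1 a1 a2 = (\<lambda>(x, t, u, v).
     (1 / (2 * a2) * exp (- a2 * t),
      0,
      ((x + a1 / a2) * u + v) * exp (- a2 * t)))"

definition Y2 :: "real \<Rightarrow> real \<Rightarrow> yfield" where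
  "Y2 a1 a2 = (\<lambda>(x, t, u, v).
     (- (a2 * x + a1) * exp (- 2 * a2 * t),
      exp (- 2 * a2 * t),
      - 2 * (((a2 * x + a1)\<^sup>2 - a2) * u + 2 * a2 * (a2 * x + a1) * v) * exp (- 2 * a2 * t)))"

end

theory Submission
  imports Defs
begin

text \<open>
  Write \<open>b = a2 x + a1\<close>.  On the variety \<open>\<Delta>\<^sub>1 = \<Delta>\<^sub>2 = 0\<close> the jet coordinates \<open>u\<^sub>x\<close> and \<open>u\<^sub>t\<close> are
  free, while \<open>v\<^sub>x = u\<close> and \<open>v\<^sub>t = u\<^sub>x / 2 - b u\<close>.  The symmetry condition is therefore polynomial in
  \<open>u\<^sub>x\<close> and \<open>u\<^sub>t\<close>, and its coefficients are the determining equations.  They give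
  \<open>\<tau>\<^sub>x = \<tau>\<^sub>u = \<tau>\<^sub>v = 0\<close>, \<open>\<xi>\<^sub>u = \<xi>\<^sub>v = 0\<close>, \<open>\<xi>\<^sub>x = \<tau>\<^sub>t / 2\<close>, \<open>\<phi>\<^sub>u = 0\<close> and
  \<open>\<eta> = \<phi>\<^sub>x + u (\<phi>\<^sub>v - \<xi>\<^sub>x)\<close> (lemma \<open>determining_equations\<close>).

  Hence \<open>v\<close> can enter \<open>(\<xi>, \<tau>, \<eta>)\<close> only through \<open>h = \<eta>\<^sub>v\<close>.  Splitting the last determining equation
  by powers of \<open>u\<close> gives \<open>\<phi>\<^sub>v\<^sub>v = 0\<close>, then \<open>h = \<phi>\<^sub>x\<^sub>v = a2 \<xi> - \<xi>\<^sub>t + b \<tau>\<^sub>t / 2\<close>, which is affine in \<open>x\<close>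
  and free of \<open>u, v\<close>, and finally the equation \<open>\<phi>\<^sub>t + b \<phi>\<^sub>x = \<phi>\<^sub>x\<^sub>x / 2\<close> of the potential itself.
  Since \<open>h\<^sub>x\<^sub>x = 0\<close>, its derivative along \<open>x\<close> and \<open>v\<close> reads \<open>h\<^sub>t + a2 h + b h\<^sub>x = 0\<close>
  (lemma \<open>eta_v_equations\<close>).  These equations leave a two-dimensional space of functions \<open>h\<close>, spanned by \<open>exp (- a2 t)\<close> and
  \<open>b exp (- 2 a2 t)\<close> (lemma \<open>eta_v_form\<close>).  Up to a factor these are the \<open>v\<close>-derivatives of the
  \<open>\<eta>\<close>-components of the two generators, so subtracting a combination of the generators from any
  induced symmetry removes \<open>v\<close>.  As symmetries form a vector space and the two functions are linearly
  independent on every nonempty open set, this is the claim.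

  The domain is an arbitrary connected open set, on which a function with \<open>\<tau>\<^sub>x = \<tau>\<^sub>u = \<tau>\<^sub>v = 0\<close> need
  not be a function of \<open>t\<close> alone (its slices of constant \<open>t\<close> may be disconnected).  For this reason
  no equation is integrated in a single variable: all steps are identities between derivatives at
  points of the domain, and the two constants appear as functions with zero gradient on a connected
  set.
\<close>

section \<open>Functions of class \<open>C\<^sup>k\<close>\<close>

lemma C_on_differentiable: "C_on (Suc k) f S \<Longrightarrow> p \<in> S \<Longrightarrow> f differentiable (at p)"
  by simp

lemma C_on_continuous: "C_on k f S \<Longrightarrow> continuous_on S f"
  by (cases k) (auto intro!: differentiable_imp_continuous_on differentiable_at_imp_differentiable_on)

lemma C_on_Suc_imp: "C_on (Suc k) f S \<Longrightarrow> C_on k f S"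
proof (induction k arbitrary: f)
  case 0
  then show ?case using C_on_continuous[of "Suc 0" f S] by simp
next
  case (Suc k)
  then show ?case by (metis C_on.simps(2))
qed

text \<open>
  The predicate speaks about \<open>frechet_derivative\<close> of the function itself.  In the closure properties
  below a derivative formula holds only on \<open>S\<close>, and this lemma lets the formula take the place of
  \<open>frechet_derivative\<close> there.
\<close>

lemma C_on_cong:
  assumes "open S" "\<And>p. p \<in> S \<Longrightarrow> f p = g p" "C_on k f S"
  shows "C_on k g S"
  using assms(2,3)
proof (induction k arbitrary: f g)
  case 0
  then show ?case by (simp cong: continuous_on_cong)
next
  case (Suc k)
  have hd: "(g has_derivative frechet_derivative f (at p)) (at p)" if "p \<in> S" for p
    using that Suc.prems \<open>open S\<close>
    by (intro has_derivative_transform_within_open[of f _ p UNIV S g])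
       (auto simp: frechet_derivative_works[symmetric])
  have fd: "frechet_derivative g (at p) = frechet_derivative f (at p)" if "p \<in> S" for p
    using frechet_derivative_at[OF hd[OF that]] by simp
  show ?case
    using Suc.prems hd fd by (auto simp: differentiable_def intro: Suc.IH[rotated])
qed

lemma C_on_const: "C_on k (\<lambda>p. c) S"
  by (induction k arbitrary: c) auto

lemma C_on_linear_image:
  assumes L: "bounded_linear L" and "open S" "C_on k f S"
  shows "C_on k (\<lambda>p. L (f p)) S"
  using assms(3)
proof (induction k arbitrary: f)
  case 0
  then show ?case using L by (auto intro: bounded_linear.continuous_on)
next
  case (Suc k)
  have hd: "((\<lambda>p. L (f p)) has_derivative (\<lambda>h. L (frechet_derivative f (at p) h))) (at p)"
    if "p \<in> S" for p
    using that Suc.prems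
    by (intro bounded_linear.has_derivative[OF L]) (auto simp: frechet_derivative_works[symmetric])
  have "C_on k (\<lambda>p. frechet_derivative (\<lambda>p. L (f p)) (at p) b) S" if "b \<in> Basis" for b
  proof (rule C_on_cong[OF \<open>open S\<close>])
    show "C_on k (\<lambda>p. L (frechet_derivative f (at p) b)) S"
      using Suc that by auto
  qed (simp add: frechet_derivative_at[OF hd, symmetric])
  then show ?case using hd by (auto simp: differentiable_def)
qed

lemma C_on_linear:
  assumes "bounded_linear f" shows "C_on k f S"
proof (cases k)
  case 0
  then show ?thesis using assms by (simp add: linear_continuous_on)
next
  case (Suc j)
  have "(f has_derivative f) (at p)" for p
    using assms by (rule bounded_linear_imp_has_derivative)
  then show ?thesis
    using Suc frechet_derivative_at[of f f] by (auto simp: C_on_const differentiable_def)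
qed

lemma C_on_add:
  assumes "open S" "C_on k f S" "C_on k g S"
  shows "C_on k (\<lambda>p. f p + g p) S"
  using assms(2,3)
proof (induction k arbitrary: f g)
  case 0
  then show ?case by (auto intro: continuous_intros)
next
  case (Suc k)
  have hd: "((\<lambda>p. f p + g p) has_derivative
      (\<lambda>h. frechet_derivative f (at p) h + frechet_derivative g (at p) h)) (at p)"
    if "p \<in> S" for p
    using that Suc.prems
    by (intro has_derivative_add) (auto simp: frechet_derivative_works[symmetric])
  have "C_on k (\<lambda>p. frechet_derivative (\<lambda>p. f p + g p) (at p) b) S" if "b \<in> Basis" for b
  proof (rule C_on_cong[OF \<open>open S\<close>])
    show "C_on k (\<lambda>p. frechet_derivative f (at p) b + frechet_derivative g (at p) b) S"
      using Suc that by auto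
  qed (simp add: frechet_derivative_at[OF hd, symmetric])
  then show ?case using hd by (auto simp: differentiable_def)
qed

lemma C_on_mult:
  fixes f g :: "'a::euclidean_space \<Rightarrow> real"
  assumes "open S" "C_on k f S" "C_on k g S"
  shows "C_on k (\<lambda>p. f p * g p) S"
  using assms(2,3)
proof (induction k arbitrary: f g)
  case 0
  then show ?case by (auto intro: continuous_intros)
next
  case (Suc k)
  have hd: "((\<lambda>p. f p * g p) has_derivative
      (\<lambda>h. f p * frechet_derivative g (at p) h + frechet_derivative f (at p) h * g p)) (at p)"
    if "p \<in> S" for p
    using that Suc.prems
    by (intro has_derivative_mult) (auto simp: frechet_derivative_works[symmetric])
  have "C_on k (\<lambda>p. frechet_derivative (\<lambda>p. f p * g p) (at p) b) S" if "b \<in> Basis" for b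
  proof (rule C_on_cong[OF \<open>open S\<close>])
    show "C_on k (\<lambda>p. f p * frechet_derivative g (at p) b + frechet_derivative f (at p) b * g p) S"
      using Suc.IH Suc.prems that C_on_Suc_imp[OF Suc.prems(1)] C_on_Suc_imp[OF Suc.prems(2)]
      by (intro C_on_add[OF \<open>open S\<close>]) auto
  qed (simp add: frechet_derivative_at[OF hd, symmetric])
  then show ?case using hd by (auto simp: differentiable_def)
qed

lemma C_on_exp:
  fixes f :: "'a::euclidean_space \<Rightarrow> real"
  assumes "open S" "C_on k f S"
  shows "C_on k (\<lambda>p. exp (f p)) S"
  using assms(2)
proof (induction k)
  case 0
  then show ?case by (auto intro: continuous_intros)
next
  case (Suc k)
  have hd: "((\<lambda>p. exp (f p)) has_derivative
      (\<lambda>h. exp (f p) * frechet_derivative f (at p) h)) (at p)"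
    if "p \<in> S" for p
    using that Suc.prems
    by (auto intro!: derivative_eq_intros simp: frechet_derivative_works)
  have "C_on k (\<lambda>p. frechet_derivative (\<lambda>p. exp (f p)) (at p) b) S" if "b \<in> Basis" for b
  proof (rule C_on_cong[OF \<open>open S\<close>])
    show "C_on k (\<lambda>p. exp (f p) * frechet_derivative f (at p) b) S"
      using Suc.prems that Suc.IH[OF C_on_Suc_imp[OF Suc.prems]]
      by (intro C_on_mult[OF \<open>open S\<close>]) auto
  qed (simp add: frechet_derivative_at[OF hd, symmetric])
  then show ?case using hd by (auto simp: differentiable_def)
qed

lemma C_on_Pair:
  assumes "open S" "C_on k f S" "C_on k g S"
  shows "C_on k (\<lambda>p. (f p, g p)) S"
proof -
  have "C_on k (\<lambda>p. (f p, 0) + (0, g p)) S"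
    using assms
    by (intro C_on_add C_on_linear_image[of "\<lambda>y. (y, 0)"] C_on_linear_image[of "\<lambda>y. (0, y)"])
       (auto intro!: bounded_linear_Pair bounded_linear_ident bounded_linear_zero)
  then show ?thesis by simp
qed

text \<open>
  The second difference of \<open>f\<close> over a parallelogram is a second derivative at an inner point:
  the mean value theorem is applied along \<open>a\<close> to a difference along \<open>b\<close>, then along \<open>b\<close>.
\<close>

lemma mixed_difference_mvt:
  fixes f :: "'a::real_normed_vector \<Rightarrow> real" and p a b :: 'a
  assumes "0 < s"
    and f: "\<And>x y. 0 \<le> x \<Longrightarrow> x \<le> s \<Longrightarrow> 0 \<le> y \<Longrightarrow> y \<le> s \<Longrightarrow>
          f differentiable (at (p + x *\<^sub>R a + y *\<^sub>R b))"
    and fa: "\<And>x y. 0 \<le> x \<Longrightarrow> x \<le> s \<Longrightarrow> 0 \<le> y \<Longrightarrow> y \<le> s \<Longrightarrow>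
          (\<lambda>q. frechet_derivative f (at q) a) differentiable (at (p + x *\<^sub>R a + y *\<^sub>R b))"
  obtains x y where "0 < x" "x < s" "0 < y" "y < s"
    "f (p + s *\<^sub>R a + s *\<^sub>R b) - f (p + s *\<^sub>R a) - (f (p + s *\<^sub>R b) - f p)
       = s\<^sup>2 * frechet_derivative (\<lambda>q. frechet_derivative f (at q) a)
                 (at (p + x *\<^sub>R a + y *\<^sub>R b)) b"
proof -
  define fa where "fa q = frechet_derivative f (at q) a" for q
  have dx: "((\<lambda>x. f (p + x *\<^sub>R a + y *\<^sub>R b)) has_real_derivative fa (p + x *\<^sub>R a + y *\<^sub>R b)) (at x)"
    if "0 \<le> x" "x \<le> s" "0 \<le> y" "y \<le> s" for x y
  proof -
    have "(f has_derivative frechet_derivative f (at (p + x *\<^sub>R a + y *\<^sub>R b)))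
            (at (p + x *\<^sub>R a + y *\<^sub>R b))"
      using f[OF that] by (simp add: frechet_derivative_works)
    then have "((\<lambda>x. f (p + x *\<^sub>R a + y *\<^sub>R b)) has_derivative
        (\<lambda>h. frechet_derivative f (at (p + x *\<^sub>R a + y *\<^sub>R b)) (h *\<^sub>R a))) (at x)"
      by (rule has_derivative_compose[rotated]) (auto intro!: derivative_eq_intros)
    moreover have "linear (frechet_derivative f (at (p + x *\<^sub>R a + y *\<^sub>R b)))"
      using f[OF that] by (rule linear_frechet_derivative)
    ultimately show ?thesis
      by (simp add: has_field_derivative_def linear_cmul fa_def mult_commute_abs)
  qed
  have dy: "((\<lambda>y. fa (p + x *\<^sub>R a + y *\<^sub>R b)) has_real_derivative
        frechet_derivative fa (at (p + x *\<^sub>R a + y *\<^sub>R b)) b) (at y)"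
    if "0 \<le> x" "x \<le> s" "0 \<le> y" "y \<le> s" for x y
  proof -
    have fa': "fa differentiable (at (p + x *\<^sub>R a + y *\<^sub>R b))"
      using fa[OF that] unfolding fa_def .
    then have "(fa has_derivative frechet_derivative fa (at (p + x *\<^sub>R a + y *\<^sub>R b)))
            (at (p + x *\<^sub>R a + y *\<^sub>R b))"
      by (simp add: frechet_derivative_works)
    then have "((\<lambda>y. fa (p + x *\<^sub>R a + y *\<^sub>R b)) has_derivative
        (\<lambda>h. frechet_derivative fa (at (p + x *\<^sub>R a + y *\<^sub>R b)) (h *\<^sub>R b))) (at y)"
      by (rule has_derivative_compose[rotated]) (auto intro!: derivative_eq_intros)
    moreover have "linear (frechet_derivative fa (at (p + x *\<^sub>R a + y *\<^sub>R b)))"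
      using fa' by (rule linear_frechet_derivative)
    ultimately show ?thesis
      by (simp add: has_field_derivative_def linear_cmul mult_commute_abs)
  qed
  have "\<exists>x. 0 < x \<and> x < s \<and>
      (f (p + s *\<^sub>R a + s *\<^sub>R b) - f (p + s *\<^sub>R a + 0 *\<^sub>R b))
        - (f (p + 0 *\<^sub>R a + s *\<^sub>R b) - f (p + 0 *\<^sub>R a + 0 *\<^sub>R b))
      = (s - 0) * (fa (p + x *\<^sub>R a + s *\<^sub>R b) - fa (p + x *\<^sub>R a + 0 *\<^sub>R b))"
    by (rule MVT2[OF \<open>0 < s\<close>], rule DERIV_diff; rule dx) (use \<open>0 < s\<close> in auto)
  then obtain x where x: "0 < x" "x < s" and
    1: "f (p + s *\<^sub>R a + s *\<^sub>R b) - f (p + s *\<^sub>R a) - (f (p + s *\<^sub>R b) - f p)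
      = s * (fa (p + x *\<^sub>R a + s *\<^sub>R b) - fa (p + x *\<^sub>R a + 0 *\<^sub>R b))"
    by auto
  have "\<exists>y. 0 < y \<and> y < s \<and> fa (p + x *\<^sub>R a + s *\<^sub>R b) - fa (p + x *\<^sub>R a + 0 *\<^sub>R b)
      = (s - 0) * frechet_derivative fa (at (p + x *\<^sub>R a + y *\<^sub>R b)) b"
    by (rule MVT2[OF \<open>0 < s\<close>], rule dy) (use x in auto)
  then show ?thesis
    using that x 1 unfolding fa_def by (auto simp: power2_eq_square)
qed

text \<open>
  The second difference is symmetric in \<open>a\<close> and \<open>b\<close>, so on arbitrarily small parallelograms both
  mixed derivatives take a common value, though at different points; continuity at \<open>p\<close> makes them
  equal there.
\<close>

lemma second_derivative_symmetric:
  fixes f :: "'a::euclidean_space \<Rightarrow> real"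
  assumes "open S" "C_on 2 f S" "p \<in> S" "a \<in> Basis" "b \<in> Basis"
  shows "frechet_derivative (\<lambda>q. frechet_derivative f (at q) a) (at p) b
       = frechet_derivative (\<lambda>q. frechet_derivative f (at q) b) (at p) a" (is "?A p = ?B p")
proof (rule ccontr)
  assume ne: "?A p \<noteq> ?B p"
  define e where "e = \<bar>?A p - ?B p\<bar> / 2"
  have "0 < e" using ne by (simp add: e_def)
  have sm: "\<And>q. q \<in> S \<Longrightarrow> f differentiable (at q)"
    "\<And>q c. q \<in> S \<Longrightarrow> c \<in> Basis \<Longrightarrow> (\<lambda>q. frechet_derivative f (at q) c) differentiable (at q)"
    and "continuous_on S ?A" "continuous_on S ?B"
    using assms by (auto simp: numeral_2_eq_2)
  then have "isCont ?A p" "isCont ?B p"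
    using assms by (auto simp: continuous_on_eq_continuous_at)
  then have "\<forall>\<^sub>F q in nhds p. dist (?A q) (?A p) < e" "\<forall>\<^sub>F q in nhds p. dist (?B q) (?B p) < e"
    using \<open>0 < e\<close> by (auto simp: continuous_at_eps_delta eventually_nhds_metric)
  moreover have "\<forall>\<^sub>F q in nhds p. q \<in> S"
    using assms by (simp add: eventually_nhds_in_open)
  ultimately have "\<forall>\<^sub>F q in nhds p. q \<in> S \<and> dist (?A q) (?A p) < e \<and> dist (?B q) (?B p) < e"
    by eventually_elim auto
  then obtain d where "0 < d" and d: "\<And>q. dist q p < d \<Longrightarrow>
      q \<in> S \<and> dist (?A q) (?A p) < e \<and> dist (?B q) (?B p) < e"
    unfolding eventually_nhds_metric by blast
  define s where "s = d / 3"
  have s: "0 < s" using \<open>0 < d\<close> by (simp add: s_def)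
  have near: "dist (p + x *\<^sub>R a + y *\<^sub>R b) p < d" if "0 \<le> x" "x \<le> s" "0 \<le> y" "y \<le> s" for x y
  proof -
    have "norm (x *\<^sub>R a + y *\<^sub>R b) \<le> x + y"
      using norm_triangle_ineq[of "x *\<^sub>R a" "y *\<^sub>R b"] that assms by simp
    then show ?thesis using that \<open>0 < d\<close> by (simp add: dist_norm s_def add.assoc)
  qed
  have comm: "p + x *\<^sub>R b + y *\<^sub>R a = p + y *\<^sub>R a + x *\<^sub>R b" for x y
    by simp
  obtain x y where xy: "0 < x" "x < s" "0 < y" "y < s" and
    1: "f (p + s *\<^sub>R a + s *\<^sub>R b) - f (p + s *\<^sub>R a) - (f (p + s *\<^sub>R b) - f p)
       = s\<^sup>2 * ?A (p + x *\<^sub>R a + y *\<^sub>R b)"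
    by (rule mixed_difference_mvt[OF s, of f p a b]) (use sm d near assms in blast)+
  obtain x' y' where xy': "0 < x'" "x' < s" "0 < y'" "y' < s" and
    2: "f (p + s *\<^sub>R b + s *\<^sub>R a) - f (p + s *\<^sub>R b) - (f (p + s *\<^sub>R a) - f p)
       = s\<^sup>2 * ?B (p + x' *\<^sub>R b + y' *\<^sub>R a)"
    by (rule mixed_difference_mvt[OF s, of f p b a]; (unfold comm)?) (use sm d near assms in blast)+
  have "?A (p + x *\<^sub>R a + y *\<^sub>R b) = ?B (p + y' *\<^sub>R a + x' *\<^sub>R b)"
    using 1 2 s by (simp add: comm algebra_simps)
  moreover have "\<bar>?A (p + x *\<^sub>R a + y *\<^sub>R b) - ?A p\<bar> < e"
    using d[OF near[of x y]] xy by (simp add: dist_real_def)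
  moreover have "\<bar>?B (p + y' *\<^sub>R a + x' *\<^sub>R b) - ?B p\<bar> < e"
    using d[OF near[of y' x']] xy' by (simp add: dist_real_def)
  ultimately have "\<bar>?A p - ?B p\<bar> < 2 * e"
    by (smt (verit) field_sum_of_halves)
  then show False
    by (simp add: e_def)
qed

lemma smooth_on_add: "open S \<Longrightarrow> smooth_on f S \<Longrightarrow> smooth_on g S \<Longrightarrow> smooth_on (\<lambda>p. f p + g p) S"
  by (simp add: smooth_on_def C_on_add)

lemma smooth_on_mult:
  fixes f g :: "'a::euclidean_space \<Rightarrow> real"
  shows "open S \<Longrightarrow> smooth_on f S \<Longrightarrow> smooth_on g S \<Longrightarrow> smooth_on (\<lambda>p. f p * g p) S"
  by (simp add: smooth_on_def C_on_mult)

lemma smooth_on_exp: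
  fixes f :: "'a::euclidean_space \<Rightarrow> real"
  shows "open S \<Longrightarrow> smooth_on f S \<Longrightarrow> smooth_on (\<lambda>p. exp (f p)) S"
  by (simp add: smooth_on_def C_on_exp)

lemma smooth_on_Pair:
  "open S \<Longrightarrow> smooth_on f S \<Longrightarrow> smooth_on g S \<Longrightarrow> smooth_on (\<lambda>p. (f p, g p)) S"
  by (simp add: smooth_on_def C_on_Pair)

lemma smooth_on_linear_image:
  "bounded_linear L \<Longrightarrow> open S \<Longrightarrow> smooth_on f S \<Longrightarrow> smooth_on (\<lambda>p. L (f p)) S"
  by (simp add: smooth_on_def C_on_linear_image)

lemma smooth_on_const: "smooth_on (\<lambda>p. c) S"
  by (simp add: smooth_on_def C_on_const)

lemma smooth_on_linear: "bounded_linear f \<Longrightarrow> smooth_on f S"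
  by (simp add: smooth_on_def C_on_linear)

lemma smooth_on_cong:
  "open S \<Longrightarrow> (\<And>p. p \<in> S \<Longrightarrow> f p = g p) \<Longrightarrow> smooth_on f S \<Longrightarrow> smooth_on g S"
  unfolding smooth_on_def using C_on_cong by blast

section \<open>Directional derivatives on the space of \<open>(x, t, u, v)\<close>\<close>

text \<open>
  One constant for the four coordinate directions, so that the rules of differentiation and the
  symmetry of second derivatives need only one form.
\<close>

definition ddir :: "point \<Rightarrow> (point \<Rightarrow> real) \<Rightarrow> point \<Rightarrow> real" where
  "ddir e f p = frechet_derivative f (at p) e"

abbreviation "e\<^sub>x \<equiv> (1, 0, 0, 0) :: point"
abbreviation "e\<^sub>t \<equiv> (0, 1, 0, 0) :: point"
abbreviation "e\<^sub>u \<equiv> (0, 0, 1, 0) :: point"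
abbreviation "e\<^sub>v \<equiv> (0, 0, 0, 1) :: point"

lemma point_Basis: "(Basis :: point set) = {e\<^sub>x, e\<^sub>t, e\<^sub>u, e\<^sub>v}"
  by (auto simp: Basis_prod_def zero_prod_def)

lemma pd_eq_ddir: "pd_x = ddir e\<^sub>x" "pd_t = ddir e\<^sub>t" "pd_u = ddir e\<^sub>u" "pd_v = ddir e\<^sub>v"
  by (auto simp: pd_x_def pd_t_def pd_u_def pd_v_def ddir_def fun_eq_iff)

lemma ddir_eqI: "(f has_derivative f') (at p) \<Longrightarrow> ddir e f p = f' e"
  unfolding ddir_def using frechet_derivative_at by metis

lemma ddir_const: "ddir e (\<lambda>q. c) p = 0"
  by (simp add: ddir_def)

lemma ddir_coords:
  "ddir e (\<lambda>q. fst q) p = fst e"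
  "ddir e (\<lambda>q. fst (snd q)) p = fst (snd e)"
  "ddir e (\<lambda>q. fst (snd (snd q))) p = fst (snd (snd e))"
  "ddir e (\<lambda>q. snd (snd (snd q))) p = snd (snd (snd e))"
  by (rule ddir_eqI, auto intro!: derivative_eq_intros)+

context
  fixes f g :: "point \<Rightarrow> real" and p :: point
  assumes f: "f differentiable (at p)" and g: "g differentiable (at p)"
begin

lemma ddir_add: "ddir e (\<lambda>q. f q + g q) p = ddir e f p + ddir e g p"
  using f g unfolding frechet_derivative_works ddir_def[of e f] ddir_def[of e g]
  by (intro ddir_eqI) (auto intro!: derivative_eq_intros)

lemma ddir_diff: "ddir e (\<lambda>q. f q - g q) p = ddir e f p - ddir e g p"
  using f g unfolding frechet_derivative_works ddir_def[of e f] ddir_def[of e g]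
  by (intro ddir_eqI) (auto intro!: derivative_eq_intros)

lemma ddir_mult: "ddir e (\<lambda>q. f q * g q) p = ddir e f p * g p + f p * ddir e g p"
  using f g unfolding frechet_derivative_works ddir_def[of e f] ddir_def[of e g]
  by (intro ddir_eqI[of _ "\<lambda>h. frechet_derivative f (at p) h * g p + f p * frechet_derivative g (at p) h", THEN trans])
     (auto intro!: derivative_eq_intros)

end

lemma ddir_minus: "f differentiable (at p) \<Longrightarrow> ddir e (\<lambda>q. - f q) p = - ddir e f p"
  using ddir_diff[of "\<lambda>q. 0" p f e] by (simp add: ddir_const)

lemma ddir_divide: "f differentiable (at p) \<Longrightarrow> ddir e (\<lambda>q. f q / c) p = ddir e f p / c"
  using ddir_mult[of f p "\<lambda>q. 1 / c" e] by (simp add: ddir_const)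

lemma ddir_exp:
  assumes "f differentiable (at p)"
  shows "ddir e (\<lambda>q. exp (f q)) p = exp (f p) * ddir e f p"
  using assms unfolding frechet_derivative_works ddir_def[of e f]
  by (intro ddir_eqI[of _ "\<lambda>h. exp (f p) * frechet_derivative f (at p) h"])
     (auto intro!: derivative_eq_intros)

lemma differentiable_exp_comp:
  fixes f :: "'a::real_normed_vector \<Rightarrow> real"
  shows "f differentiable (at p) \<Longrightarrow> (\<lambda>q. exp (f q)) differentiable (at p)"
  unfolding differentiable_def using has_derivative_exp by blast

lemma differentiable_coords:
  fixes p :: point
  shows "(\<lambda>q. fst q) differentiable (at p)" "(\<lambda>q. fst (snd q)) differentiable (at p)"
    "(\<lambda>q. fst (snd (snd q))) differentiable (at p)" "(\<lambda>q. snd (snd (snd q))) differentiable (at p)"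
  unfolding differentiable_def by (rule exI, auto intro!: derivative_eq_intros)+

lemmas ddir_rules = ddir_const ddir_coords ddir_add ddir_diff ddir_mult ddir_minus ddir_divide ddir_exp
  differentiable_coords differentiable_exp_comp

text \<open>
  The gradient is determined by the four partial derivatives; this turns vanishing partial
  derivatives into a zero derivative.
\<close>

lemma has_derivative_ddir:
  assumes "f differentiable (at p)"
  shows "(f has_derivative (\<lambda>h. fst h * ddir e\<^sub>x f p + fst (snd h) * ddir e\<^sub>t f p
     + fst (snd (snd h)) * ddir e\<^sub>u f p + snd (snd (snd h)) * ddir e\<^sub>v f p)) (at p)"
proof -
  have d: "(f has_derivative frechet_derivative f (at p)) (at p)"
    using assms by (simp add: frechet_derivative_works)
  then interpret linear "frechet_derivative f (at p)"
    using has_derivative_linear by blast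
  have "frechet_derivative f (at p) = (\<lambda>h. fst h * ddir e\<^sub>x f p + fst (snd h) * ddir e\<^sub>t f p
     + fst (snd (snd h)) * ddir e\<^sub>u f p + snd (snd (snd h)) * ddir e\<^sub>v f p)"
  proof
    fix h
    have "h = fst h *\<^sub>R e\<^sub>x + fst (snd h) *\<^sub>R e\<^sub>t + fst (snd (snd h)) *\<^sub>R e\<^sub>u + snd (snd (snd h)) *\<^sub>R e\<^sub>v"
      by (simp add: prod_eq_iff)
    then have "frechet_derivative f (at p) h = frechet_derivative f (at p) \<dots>"
      by (rule arg_cong)
    then show "frechet_derivative f (at p) h = fst h * ddir e\<^sub>x f p + fst (snd h) * ddir e\<^sub>t f p
     + fst (snd (snd h)) * ddir e\<^sub>u f p + snd (snd (snd h)) * ddir e\<^sub>v f p"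
      by (simp only: add scale ddir_def real_scaleR_def)
  qed
  then show ?thesis
    using d by (simp only:)
qed

locale open_domain =
  fixes U :: "point set"
  assumes open_U: "open U"
begin

lemma smooth_ddir: "smooth_on f U \<Longrightarrow> e \<in> Basis \<Longrightarrow> smooth_on (ddir e f) U"
  unfolding smooth_on_def ddir_def[abs_def] by (metis C_on.simps(2))

lemma smooth_differentiable: "smooth_on f U \<Longrightarrow> p \<in> U \<Longrightarrow> f differentiable (at p)"
  for f :: "point \<Rightarrow> real"
  using C_on_differentiable unfolding smooth_on_def by blast

lemma ddir_commute:
  "smooth_on f U \<Longrightarrow> p \<in> U \<Longrightarrow> e \<in> Basis \<Longrightarrow> e' \<in> Basis \<Longrightarrow> ddir e (ddir e' f) p = ddir e' (ddir e f) p"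
  unfolding ddir_def[abs_def] smooth_on_def
  by (rule second_derivative_symmetric[OF open_U]) auto

lemma ddir_cong:
  assumes "\<And>q. q \<in> U \<Longrightarrow> f q = g q" "p \<in> U" "f differentiable (at p)"
  shows "ddir e f p = ddir e g p"
  unfolding ddir_def using frechet_derivative_transform_within_open[OF assms(3) open_U assms(2,1)]
  by simp

lemma ddir_zero:
  assumes "\<And>q. q \<in> U \<Longrightarrow> f q = 0" "p \<in> U"
  shows "ddir e f p = 0"
  using ddir_cong[of "\<lambda>q. 0" f p e] assms by (simp add: ddir_const)

text \<open>
  With the hypothesis as one closed formula, an identity between several functions determines \<open>f\<close>
  by unification; the rule form above suits a single function.
\<close>

lemma ddir_zero_ball: "\<forall>q\<in>U. f q = 0 \<Longrightarrow> p \<in> U \<Longrightarrow> ddir e f p = 0"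
  using ddir_zero by blast

lemma constant_if_ddir_zero:
  assumes "connected U" "\<And>p. p \<in> U \<Longrightarrow> f differentiable (at p)"
    and "\<And>p e. p \<in> U \<Longrightarrow> e \<in> Basis \<Longrightarrow> ddir e f p = 0"
  obtains c where "\<And>p. p \<in> U \<Longrightarrow> f p = c"
proof -
  have "(f has_derivative (\<lambda>h. 0)) (at p)" if "p \<in> U" for p
    using has_derivative_ddir[OF assms(2)[OF that]] assms(3)[OF that] by (simp add: point_Basis)
  then have "f p = f q" if "p \<in> U" "q \<in> U" for p q
    using has_derivative_zero_unique_connected[OF open_U assms(1)] that by blast
  then show ?thesis using that by blast
qed

end

section \<open>The symmetry condition on the solution variety\<close>

lemma Delta1_has_derivative:
  "(Delta1 a1 a2 has_derivative (\<lambda>((hx, ht, hu, hv), hux, hut, hvx, hvt).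
      hvt + a2 * hx * fst (snd (snd (fst z))) + (a2 * fst (fst z) + a1) * hu - hux / 2)) (at z)"
  unfolding Delta1_def case_prod_beta
  by (auto intro!: derivative_eq_intros simp: algebra_simps)

lemma Delta2_has_derivative:
  "(Delta2 has_derivative (\<lambda>((hx, ht, hu, hv), hux, hut, hvx, hvt). hvx - hu)) (at z)"
  unfolding Delta2_def case_prod_beta
  by (auto intro!: derivative_eq_intros)

text \<open>
  The constraints are solved for \<open>v\<^sub>x\<close> and \<open>v\<^sub>t\<close>, which leaves two identities in the free jet
  coordinates \<open>s = u\<^sub>x\<close> and \<open>r = u\<^sub>t\<close>; \<open>w\<close> is the resulting value of \<open>v\<^sub>t\<close>, and \<open>Dx\<close>, \<open>Dt\<close> are the
  total derivatives on the constraint variety.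
\<close>

lemma point_symmetry_iff:
  "point_symmetry a1 a2 U (\<lambda>p. (X p, T p, E p, P p)) \<longleftrightarrow>
   smooth_on (\<lambda>p. (X p, T p, E p, P p)) U \<and>
   (\<forall>x t u v s r. (x, t, u, v) \<in> U \<longrightarrow>
     (let p = (x, t, u, v); w = s / 2 - (a2 * x + a1) * u;
          Dx = (\<lambda>f. ddir e\<^sub>x f p + s * ddir e\<^sub>u f p + u * ddir e\<^sub>v f p);
          Dt = (\<lambda>f. ddir e\<^sub>t f p + r * ddir e\<^sub>u f p + w * ddir e\<^sub>v f p)
      in Dt P - u * Dt X - w * Dt T + a2 * X p * u + (a2 * x + a1) * E p
           - (Dx E - s * Dx X - r * Dx T) / 2 = 0 \<and>
         Dx P - u * Dx X - w * Dx T - E p = 0))"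
proof -
  have on_shell: "Delta1 a1 a2 ((x, t, u, v), s, r, vx, w) = 0 \<and> Delta2 ((x, t, u, v), s, r, vx, w) = 0
      \<longleftrightarrow> vx = u \<and> w = s / 2 - (a2 * x + a1) * u" for x t u v s r vx w
    unfolding Delta1_def Delta2_def prod.case by argo
  show ?thesis
    unfolding point_symmetry_def split_paired_All fst_conv on_shell
    by (simp add: apply_field_def frechet_derivative_at[OF Delta1_has_derivative, symmetric]
        frechet_derivative_at[OF Delta2_has_derivative, symmetric] prolongation_def total_x_def total_t_def
        pd_eq_ddir Let_def)
qed

lemma quadratic_vanishes:
  fixes A B C :: real
  assumes "\<And>s. A + B * s + C * s\<^sup>2 = 0"
  shows "A = 0" "B = 0" "C = 0"
  using assms[of 0] assms[of 1] assms[of "-1"] by auto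

context open_domain
begin

lemma smooth_components:
  assumes "smooth_on (\<lambda>p. (X p, T p, E p, P p)) U"
  shows "smooth_on X U" "smooth_on T U" "smooth_on E U" "smooth_on P U"
  using smooth_on_linear_image[OF _ open_U assms, of fst]
    smooth_on_linear_image[OF _ open_U assms, of "\<lambda>w. fst (snd w)"]
    smooth_on_linear_image[OF _ open_U assms, of "\<lambda>w. fst (snd (snd w))"]
    smooth_on_linear_image[OF _ open_U assms, of "\<lambda>w. snd (snd (snd w))"]
  by (simp_all add: bounded_linear_fst bounded_linear_fst_comp bounded_linear_snd_comp
      bounded_linear_ident)

section \<open>The determining equations\<close>

text \<open>
  The coefficients of \<open>u\<^sub>x\<close> and \<open>u\<^sub>t\<close> alone do not give all of these equations.  Two of them,
  \<open>\<tau>\<^sub>x + u \<tau>\<^sub>v = 0\<close> and \<open>2 \<xi>\<^sub>x + 2 u \<xi>\<^sub>v = \<tau>\<^sub>t\<close>, still contain \<open>u\<close> as a factor of functions that do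
  not depend on \<open>u\<close>; a derivative in \<open>u\<close> separates their terms.
\<close>

lemma determining_equations:
  fixes X T E P :: "point \<Rightarrow> real" and a1 a2 :: real
  defines "b \<equiv> \<lambda>q::point. a2 * fst q + a1" and "\<nu> \<equiv> \<lambda>q::point. fst (snd (snd q))"
  assumes sym: "point_symmetry a1 a2 U (\<lambda>p. (X p, T p, E p, P p))"
  shows "\<And>p. p \<in> U \<Longrightarrow> ddir e\<^sub>x T p = 0" "\<And>p. p \<in> U \<Longrightarrow> ddir e\<^sub>u T p = 0" "\<And>p. p \<in> U \<Longrightarrow> ddir e\<^sub>v T p = 0"
    "\<And>p. p \<in> U \<Longrightarrow> ddir e\<^sub>u X p = 0" "\<And>p. p \<in> U \<Longrightarrow> ddir e\<^sub>v X p = 0"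
    "\<And>p. p \<in> U \<Longrightarrow> ddir e\<^sub>x X p = ddir e\<^sub>t T p / 2"
    "\<And>p. p \<in> U \<Longrightarrow> ddir e\<^sub>u P p = 0"
    "\<And>p. p \<in> U \<Longrightarrow> E p = ddir e\<^sub>x P p + \<nu> p * (ddir e\<^sub>v P p - ddir e\<^sub>x X p)"
    "\<And>p. p \<in> U \<Longrightarrow> ddir e\<^sub>t P p - b p * \<nu> p * ddir e\<^sub>v P p - \<nu> p * ddir e\<^sub>t X p
       + b p * \<nu> p * ddir e\<^sub>t T p + a2 * \<nu> p * X p + b p * E p
       - (ddir e\<^sub>x E p + \<nu> p * ddir e\<^sub>v E p) / 2 = 0"
proof -
  note [simp] = smooth_components[OF sym[unfolded point_symmetry_iff, THEN conjunct1]]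
    smooth_ddir point_Basis ddir_rules
  have D [simp]: "f differentiable (at p)" if "smooth_on f U" "p \<in> U" for f :: "point \<Rightarrow> real" and p
    using that by (rule smooth_differentiable)
  have \<nu> [simp]: "\<nu> differentiable (at p)" "ddir e\<^sub>x \<nu> p = 0" "ddir e\<^sub>u \<nu> p = 1" for p
    by (simp_all add: \<nu>_def)
  have det1: "ddir e\<^sub>t P p + r * ddir e\<^sub>u P p + (s / 2 - b p * \<nu> p) * ddir e\<^sub>v P p
      - \<nu> p * (ddir e\<^sub>t X p + r * ddir e\<^sub>u X p + (s / 2 - b p * \<nu> p) * ddir e\<^sub>v X p)
      - (s / 2 - b p * \<nu> p) * (ddir e\<^sub>t T p + r * ddir e\<^sub>u T p + (s / 2 - b p * \<nu> p) * ddir e\<^sub>v T p)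
      + a2 * X p * \<nu> p + b p * E p
      - (ddir e\<^sub>x E p + s * ddir e\<^sub>u E p + \<nu> p * ddir e\<^sub>v E p
          - s * (ddir e\<^sub>x X p + s * ddir e\<^sub>u X p + \<nu> p * ddir e\<^sub>v X p)
          - r * (ddir e\<^sub>x T p + s * ddir e\<^sub>u T p + \<nu> p * ddir e\<^sub>v T p)) / 2 = 0"
   and det2: "ddir e\<^sub>x P p + s * ddir e\<^sub>u P p + \<nu> p * ddir e\<^sub>v P p
      - \<nu> p * (ddir e\<^sub>x X p + s * ddir e\<^sub>u X p + \<nu> p * ddir e\<^sub>v X p)
      - (s / 2 - b p * \<nu> p) * (ddir e\<^sub>x T p + s * ddir e\<^sub>u T p + \<nu> p * ddir e\<^sub>v T p) - E p = 0"
    if "p \<in> U" for p s r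
    using sym[unfolded point_symmetry_iff, THEN conjunct2, rule_format,
        of "fst p" "fst (snd p)" "fst (snd (snd p))" "snd (snd (snd p))" s r] that
    by (simp_all add: Let_def b_def \<nu>_def)
  have q2: "ddir e\<^sub>x P p + \<nu> p * ddir e\<^sub>v P p - \<nu> p * ddir e\<^sub>x X p - (\<nu> p)\<^sup>2 * ddir e\<^sub>v X p
        + b p * \<nu> p * (ddir e\<^sub>x T p + \<nu> p * ddir e\<^sub>v T p) - E p
      + (ddir e\<^sub>u P p - \<nu> p * ddir e\<^sub>u X p - (ddir e\<^sub>x T p + \<nu> p * ddir e\<^sub>v T p) / 2
        + b p * \<nu> p * ddir e\<^sub>u T p) * s
      + (- ddir e\<^sub>u T p / 2) * s\<^sup>2 = 0" if "p \<in> U" for p s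
    using det2[OF that, of s] by (simp add: field_simps power2_eq_square)
  \<comment> \<open>The coefficients of \<open>u\<^sub>x\<^sup>2\<close> and \<open>u\<^sub>x\<close> in \<open>det2\<close>.\<close>
  have Tu: "ddir e\<^sub>u T p = 0" if "p \<in> U" for p
    using quadratic_vanishes(3)[OF q2[OF that]] by simp
  have Pu1: "ddir e\<^sub>u P p - \<nu> p * ddir e\<^sub>u X p = (ddir e\<^sub>x T p + \<nu> p * ddir e\<^sub>v T p) / 2"
    if "p \<in> U" for p
    using quadratic_vanishes(2)[OF q2[OF that]] Tu[OF that] by simp
  \<comment> \<open>The coefficient of \<open>u\<^sub>t\<close> in \<open>det1\<close> is \<open>Pu1\<close> with the opposite sign on the right.\<close>
  have Pu2: "ddir e\<^sub>u P p - \<nu> p * ddir e\<^sub>u X p = - (ddir e\<^sub>x T p + \<nu> p * ddir e\<^sub>v T p) / 2"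
    if "p \<in> U" for p
    using det1[OF that, of 1 0] det1[OF that, of 0 0] Tu[OF that] by (simp add: field_simps)
  have Txv: "ddir e\<^sub>x T p = - \<nu> p * ddir e\<^sub>v T p" if "p \<in> U" for p
    using Pu1[OF that] Pu2[OF that] by simp
  have Tv: "ddir e\<^sub>v T p = 0" if "p \<in> U" for p
  proof -
    have "ddir e\<^sub>u (ddir e\<^sub>x T) p = ddir e\<^sub>u (\<lambda>q. - \<nu> q * ddir e\<^sub>v T q) p"
      by (rule ddir_cong[OF Txv that]) (use that in simp_all)
    moreover have "ddir e\<^sub>u (ddir e\<^sub>x T) p = 0" "ddir e\<^sub>u (ddir e\<^sub>v T) p = 0"
      using that ddir_zero[OF Tu that] by (simp_all add: ddir_commute[of T p "e\<^sub>u"])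
    ultimately show ?thesis using that by simp
  qed
  have Tx: "ddir e\<^sub>x T p = 0" if "p \<in> U" for p
    using Txv Tv that by simp
  have Pu3: "ddir e\<^sub>u P p = \<nu> p * ddir e\<^sub>u X p" if "p \<in> U" for p
    using Pu1 Tx Tv that by simp
  have q1: "(ddir e\<^sub>t P p - b p * \<nu> p * ddir e\<^sub>v P p - \<nu> p * ddir e\<^sub>t X p + b p * (\<nu> p)\<^sup>2 * ddir e\<^sub>v X p
       + b p * \<nu> p * ddir e\<^sub>t T p + a2 * \<nu> p * X p + b p * E p
       - (ddir e\<^sub>x E p + \<nu> p * ddir e\<^sub>v E p) / 2)
     + ((ddir e\<^sub>v P p - ddir e\<^sub>t T p - ddir e\<^sub>u E p + ddir e\<^sub>x X p) / 2) * s
     + (ddir e\<^sub>u X p / 2) * s\<^sup>2 = 0" if "p \<in> U" for p s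
    using det1[OF that, of 0 s] Tu[OF that] Tv[OF that]
    by (simp add: field_simps power2_eq_square)
  have Xu: "ddir e\<^sub>u X p = 0" if "p \<in> U" for p
    using quadratic_vanishes(3)[OF q1[OF that]] by simp
  have Pu: "ddir e\<^sub>u P p = 0" if "p \<in> U" for p
    using Pu3 Xu that by simp
  have Eu: "ddir e\<^sub>u E p = ddir e\<^sub>v P p - ddir e\<^sub>t T p + ddir e\<^sub>x X p" if "p \<in> U" for p
    using quadratic_vanishes(2)[OF q1[OF that]] by simp
  have E': "E p = ddir e\<^sub>x P p + \<nu> p * (ddir e\<^sub>v P p - ddir e\<^sub>x X p) - \<nu> p * \<nu> p * ddir e\<^sub>v X p"
    if "p \<in> U" for p
    using quadratic_vanishes(1)[OF q2[OF that]] Tx[OF that] Tv[OF that]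
    by (simp add: algebra_simps power2_eq_square)
  have mixed: "ddir e\<^sub>u (ddir e f) p = 0"
    if "p \<in> U" "smooth_on f U" "\<And>p. p \<in> U \<Longrightarrow> ddir e\<^sub>u f p = 0" "e \<in> Basis" for f e p
    using ddir_commute[OF that(2,1), of "e\<^sub>u" e] ddir_zero[OF that(3,1)] that(4) by simp
  \<comment> \<open>Two expressions for \<open>\<eta>\<^sub>u\<close>: the coefficient \<open>Eu\<close>, and the derivative of \<open>E'\<close>.\<close>
  have Xxv: "2 * ddir e\<^sub>x X p + 2 * \<nu> p * ddir e\<^sub>v X p - ddir e\<^sub>t T p = 0" if "p \<in> U" for p
  proof -
    have "ddir e\<^sub>u E p = ddir e\<^sub>u (\<lambda>p. ddir e\<^sub>x P p + \<nu> p * (ddir e\<^sub>v P p - ddir e\<^sub>x X p) - \<nu> p * \<nu> p * ddir e\<^sub>v X p) p"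
      by (rule ddir_cong[OF E' that]) (use that in simp_all)
    also have "\<dots> = ddir e\<^sub>v P p - ddir e\<^sub>x X p - 2 * \<nu> p * ddir e\<^sub>v X p"
      using that mixed[OF that _ Pu] mixed[OF that _ Xu] by simp
    finally show ?thesis using Eu[OF that] by simp
  qed
  have Xv: "ddir e\<^sub>v X p = 0" if "p \<in> U" for p
  proof -
    have "ddir e\<^sub>u (\<lambda>p. 2 * ddir e\<^sub>x X p + 2 * \<nu> p * ddir e\<^sub>v X p - ddir e\<^sub>t T p) p = 0"
      by (rule ddir_zero[OF Xxv that])
    then show ?thesis
      using that mixed[OF that _ Tu] mixed[OF that _ Xu] by simp
  qed
  show "ddir e\<^sub>x T p = 0" "ddir e\<^sub>u T p = 0" "ddir e\<^sub>v T p = 0" "ddir e\<^sub>u X p = 0" "ddir e\<^sub>v X p = 0"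
    "ddir e\<^sub>x X p = ddir e\<^sub>t T p / 2" "ddir e\<^sub>u P p = 0"
    "E p = ddir e\<^sub>x P p + \<nu> p * (ddir e\<^sub>v P p - ddir e\<^sub>x X p)"
    "ddir e\<^sub>t P p - b p * \<nu> p * ddir e\<^sub>v P p - \<nu> p * ddir e\<^sub>t X p
       + b p * \<nu> p * ddir e\<^sub>t T p + a2 * \<nu> p * X p + b p * E p
       - (ddir e\<^sub>x E p + \<nu> p * ddir e\<^sub>v E p) / 2 = 0" if "p \<in> U" for p
    using Tx Tu Tv Xu Xv Pu E'[OF that] Xxv[OF that] quadratic_vanishes(1)[OF q1[OF that]] that
    by simp_all
qed

section \<open>The dependence on the potential\<close>

text \<open>
  Since \<open>X\<close>, \<open>T\<close> and \<open>P\<close> do not depend on \<open>u\<close>, the last determining equation is a quadratic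
  polynomial in \<open>u\<close> once \<open>\<eta>\<close> has been eliminated, and derivatives in \<open>u\<close> isolate its coefficients: the quadratic one makes
  \<open>\<phi>\<close> affine in \<open>v\<close>, the linear one expresses \<open>h\<close> by \<open>\<xi>\<close> and \<open>\<tau>\<close> and gives the first three
  equations, and the constant one is the evolution equation for \<open>\<phi>\<close> that gives the last.
\<close>

lemma eta_v_equations:
  fixes X T E P :: "point \<Rightarrow> real" and a1 a2 :: real
  defines "b \<equiv> \<lambda>q::point. a2 * fst q + a1" and "h \<equiv> ddir e\<^sub>v E"
  assumes sym: "point_symmetry a1 a2 U (\<lambda>p. (X p, T p, E p, P p))"
  shows "\<And>p. p \<in> U \<Longrightarrow> ddir e\<^sub>u h p = 0" "\<And>p. p \<in> U \<Longrightarrow> ddir e\<^sub>v h p = 0"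
    "\<And>p. p \<in> U \<Longrightarrow> ddir e\<^sub>x (ddir e\<^sub>x h) p = 0"
    "\<And>p. p \<in> U \<Longrightarrow> ddir e\<^sub>t h p + a2 * h p + b p * ddir e\<^sub>x h p = 0"
proof -
  define \<nu> where "\<nu> = (\<lambda>q::point. fst (snd (snd q)))"
  note [simp] = smooth_components[OF sym[unfolded point_symmetry_iff, THEN conjunct1]]
    smooth_ddir point_Basis ddir_rules
  have D [simp]: "f differentiable (at p)" if "smooth_on f U" "p \<in> U" for f :: "point \<Rightarrow> real" and p
    using that by (rule smooth_differentiable)
  have \<nu> [simp]: "\<nu> differentiable (at p)" "ddir e\<^sub>x \<nu> p = 0" "ddir e\<^sub>u \<nu> p = 1" "ddir e\<^sub>v \<nu> p = 0" for p
    by (simp_all add: \<nu>_def)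
  have b [simp]: "b differentiable (at p)" "ddir e\<^sub>x b p = a2" "ddir e\<^sub>u b p = 0" "ddir e\<^sub>v b p = 0" for p
    by (simp_all add: b_def)
  note det = determining_equations[OF sym]
  have E: "E p = ddir e\<^sub>x P p + \<nu> p * (ddir e\<^sub>v P p - ddir e\<^sub>x X p)" if "p \<in> U" for p
    using det(8)[OF that] by (simp add: \<nu>_def)
  have R0: "ddir e\<^sub>t P p - b p * \<nu> p * ddir e\<^sub>v P p - \<nu> p * ddir e\<^sub>t X p
       + b p * \<nu> p * ddir e\<^sub>t T p + a2 * \<nu> p * X p + b p * E p
       - (ddir e\<^sub>x E p + \<nu> p * ddir e\<^sub>v E p) / 2 = 0" if "p \<in> U" for p
    using det(9)[OF that] by (simp add: \<nu>_def b_def)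
  have zero: "ddir e' (ddir e f) p = 0"
    if "p \<in> U" "smooth_on f U" "\<And>p. p \<in> U \<Longrightarrow> ddir e' f p = 0" "e \<in> Basis" "e' \<in> Basis" for f e e' p
    using ddir_commute[OF that(2,1), of e' e] ddir_zero[OF that(3,1)] that(4,5) by simp
  have Xxe: "ddir e (ddir e\<^sub>x X) p = 0" if "p \<in> U" "e = e\<^sub>x \<or> e = e\<^sub>u \<or> e = e\<^sub>v" for p e
  proof -
    have "ddir e (ddir e\<^sub>x X) p = ddir e (\<lambda>p. ddir e\<^sub>t T p / 2) p"
      by (rule ddir_cong[OF det(6) that(1)]) (use that in simp_all)
    also have "\<dots> = 0"
      using that zero[OF that(1) _ det(1)] zero[OF that(1) _ det(2)] zero[OF that(1) _ det(3)] by auto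
    finally show ?thesis .
  qed
  have Pxu: "ddir e\<^sub>u (ddir e P) p = 0" if "p \<in> U" "e \<in> Basis" for e p
    using zero[OF that(1) _ det(7)] that(2) by simp
  have E_e: "ddir e E p = ddir e (ddir e\<^sub>x P) p + ddir e \<nu> p * (ddir e\<^sub>v P p - ddir e\<^sub>x X p)
      + \<nu> p * ddir e (ddir e\<^sub>v P) p" if "p \<in> U" "e = e\<^sub>x \<or> e = e\<^sub>u \<or> e = e\<^sub>v" for p e
  proof -
    have "ddir e E p = ddir e (\<lambda>p. ddir e\<^sub>x P p + \<nu> p * (ddir e\<^sub>v P p - ddir e\<^sub>x X p)) p"
      by (rule ddir_cong[OF E that(1)]) (use that in simp_all)
    then show ?thesis
      using that(1) Xxe[OF that] by simp
  qed
  \<comment> \<open>The last determining equation after elimination of \<open>\<eta>\<close>, ordered by powers of \<open>u\<close>.\<close>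
  have R: "\<forall>p\<in>U. ddir e\<^sub>t P p + b p * ddir e\<^sub>x P p - ddir e\<^sub>x (ddir e\<^sub>x P) p / 2
      + \<nu> p * (- ddir e\<^sub>t X p + b p * ddir e\<^sub>t T p / 2 + a2 * X p - ddir e\<^sub>x (ddir e\<^sub>v P) p)
      - \<nu> p * \<nu> p * (ddir e\<^sub>v (ddir e\<^sub>v P) p / 2) = 0" (is "\<forall>p\<in>U. ?R p")
  proof
    fix p assume that: "p \<in> U"
    show "?R p"
      using R0[OF that] det(6)[OF that] E_e[OF that, of "e\<^sub>x"] E_e[OF that, of "e\<^sub>v"]
        ddir_commute[of P p "e\<^sub>x" "e\<^sub>v"] E[OF that] that
      by (simp add: field_simps)
  qed
  have Peeu: "ddir e\<^sub>u (ddir e (ddir e' P)) p = 0" if "p \<in> U" "e \<in> Basis" "e' \<in> Basis" for p e e'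
    using zero[OF that(1) _ Pxu[OF _ that(3)] that(2)] that by simp
  have Ttu: "ddir e\<^sub>u (ddir e\<^sub>t T) p = 0" and Xtu: "ddir e\<^sub>u (ddir e\<^sub>t X) p = 0" if "p \<in> U" for p
    using zero[OF that _ det(2)] zero[OF that _ det(4)] by simp_all
  have R1: "\<forall>p\<in>U. (- ddir e\<^sub>t X p + b p * ddir e\<^sub>t T p / 2 + a2 * X p - ddir e\<^sub>x (ddir e\<^sub>v P) p)
      - \<nu> p * ddir e\<^sub>v (ddir e\<^sub>v P) p = 0" (is "\<forall>p\<in>U. ?R1 p")
  proof
    fix p assume that: "p \<in> U"
    show "?R1 p"
      using ddir_zero_ball[OF R that, where e="e\<^sub>u"] that Pxu[OF that] Peeu[OF that] Ttu[OF that]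
        Xtu[OF that] det(4)[OF that] det(7)[OF that]
      by (simp add: field_simps)
  qed
  have Pvv: "ddir e\<^sub>v (ddir e\<^sub>v P) p = 0" if "p \<in> U" for p
    using ddir_zero_ball[OF R1 that, where e="e\<^sub>u"] that Pxu[OF that] Peeu[OF that] Ttu[OF that]
        Xtu[OF that] det(4)[OF that] det(7)[OF that]
    by simp
  have hP: "h p = ddir e\<^sub>x (ddir e\<^sub>v P) p" if "p \<in> U" for p
    unfolding h_def using E_e[OF that, of "e\<^sub>v"] Pvv[OF that] ddir_commute[of P p "e\<^sub>x" "e\<^sub>v"] that by simp
  have hX: "h p = - ddir e\<^sub>t X p + b p * ddir e\<^sub>t T p / 2 + a2 * X p" if "p \<in> U" for p
    using R1[rule_format, OF that] Pvv[OF that] hP[OF that] by simp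
  have FP: "\<forall>p\<in>U. ddir e\<^sub>t P p + b p * ddir e\<^sub>x P p - ddir e\<^sub>x (ddir e\<^sub>x P) p / 2 = 0" (is "\<forall>p\<in>U. ?FP p")
  proof
    fix p assume that: "p \<in> U"
    show "?FP p"
      using R[rule_format, OF that] R1[rule_format, OF that] Pvv[OF that] by simp
  qed
  have sh [simp]: "smooth_on h U"
    by (simp add: h_def)
  have he: "ddir e h p = - ddir e (ddir e\<^sub>t X) p
      + (ddir e b p * ddir e\<^sub>t T p + b p * ddir e (ddir e\<^sub>t T) p) / 2 + a2 * ddir e X p"
    if "p \<in> U" for e p
    by (subst ddir_cong[OF hX that]) (use that in simp_all)
  show hu: "ddir e\<^sub>u h p = 0" if "p \<in> U" for p
    using he[OF that, of "e\<^sub>u"] Ttu[OF that]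
        Xtu[OF that] det(4)[OF that] by simp
  show hv: "ddir e\<^sub>v h p = 0" if "p \<in> U" for p
    using he[OF that, of "e\<^sub>v"] zero[OF that _ det(3), where e="e\<^sub>t"] zero[OF that _ det(5), where e="e\<^sub>t"] det(5)[OF that]
    by simp
  have hx: "ddir e\<^sub>x h p = - ddir e\<^sub>t (ddir e\<^sub>t T) p / 2 + a2 * ddir e\<^sub>t T p" if "p \<in> U" for p
  proof -
    have "ddir e\<^sub>x (ddir e\<^sub>t X) p = ddir e\<^sub>t (ddir e\<^sub>x X) p"
      using that by (simp add: ddir_commute)
    also have "\<dots> = ddir e\<^sub>t (\<lambda>q. ddir e\<^sub>t T q / 2) p"
      by (rule ddir_cong[OF det(6) that]) (use that in simp_all)
    finally show ?thesis
      using he[OF that, of "e\<^sub>x"] zero[OF that _ det(1), where e="e\<^sub>t"] det(6)[OF that] that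
      by simp
  qed
  show hxx: "ddir e\<^sub>x (ddir e\<^sub>x h) p = 0" if "p \<in> U" for p
  proof -
    have Ttx: "ddir e\<^sub>x (ddir e\<^sub>t T) p = 0" if "p \<in> U" for p
      using zero[OF that _ det(1), where e="e\<^sub>t"] by simp
    have "ddir e\<^sub>x (ddir e\<^sub>t (ddir e\<^sub>t T)) p = 0"
      by (rule zero[OF that _ Ttx]) simp_all
    then show ?thesis
      by (subst ddir_cong[OF hx that]) (use that Ttx in simp_all)
  qed
  show "ddir e\<^sub>t h p + a2 * h p + b p * ddir e\<^sub>x h p = 0" if "p \<in> U" for p
  proof -
    \<comment> \<open>The evolution equation differentiated along \<open>v\<close>; a further derivative along \<open>x\<close> finishes.\<close>
    have FPv: "\<forall>p\<in>U. ddir e\<^sub>t (ddir e\<^sub>v P) p + b p * h p - ddir e\<^sub>x h p / 2 = 0" (is "\<forall>p\<in>U. ?FPv p")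
    proof
      fix p assume that: "p \<in> U"
      have hP': "h p = ddir e\<^sub>v (ddir e\<^sub>x P) p" if "p \<in> U" for p
        using hP that by (simp add: ddir_commute[of P p "e\<^sub>v" "e\<^sub>x"])
      have "ddir e\<^sub>v (ddir e\<^sub>x (ddir e\<^sub>x P)) p = ddir e\<^sub>x (ddir e\<^sub>v (ddir e\<^sub>x P)) p"
        using that by (simp add: ddir_commute[of "ddir e\<^sub>x P" p "e\<^sub>v" "e\<^sub>x"])
      also have "\<dots> = ddir e\<^sub>x h p"
        using ddir_cong[OF hP' that] that by simp
      finally show "?FPv p"
        using ddir_zero_ball[OF FP that, where e="e\<^sub>v"] that hP'[OF that]
        by (simp add: ddir_commute[of P p "e\<^sub>v" "e\<^sub>t"])
    qed
    have "ddir e\<^sub>x (ddir e\<^sub>t (ddir e\<^sub>v P)) p = ddir e\<^sub>t (ddir e\<^sub>x (ddir e\<^sub>v P)) p"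
      using that by (simp add: ddir_commute[of "ddir e\<^sub>v P" p "e\<^sub>x" "e\<^sub>t"])
    also have "\<dots> = ddir e\<^sub>t h p"
      using ddir_cong[OF hP that] that by simp
    finally show ?thesis
      using ddir_zero_ball[OF FPv that, where e="e\<^sub>x"] that hxx[OF that] by simp
  qed
qed

text \<open>
  The equations for \<open>h\<close> imply \<open>h\<^sub>x\<^sub>t = - 2 a2 h\<^sub>x\<close>, so \<open>h\<^sub>x exp (2 a2 t)\<close> is a constant \<open>\<alpha>\<close>.
  The solution with the same \<open>h\<^sub>x\<close> that vanishes for \<open>b = 0\<close> is \<open>b h\<^sub>x / a2\<close>; the remainder
  \<open>h - b h\<^sub>x / a2\<close> is free of \<open>x\<close> and proportional to \<open>exp (- a2 t)\<close>, which gives the second constant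
  \<open>\<beta>\<close>.  The factor \<open>4 a2\<close> in the statement is the one that occurs in \<open>Y2\<close>.
\<close>

lemma eta_v_form:
  fixes X T E P :: "point \<Rightarrow> real" and a1 a2 :: real
  assumes "a2 \<noteq> 0" "connected U"
    and sym: "point_symmetry a1 a2 U (\<lambda>p. (X p, T p, E p, P p))"
  obtains c1 c2 where "\<And>x t u v. (x, t, u, v) \<in> U \<Longrightarrow>
    ddir e\<^sub>v E (x, t, u, v) = c1 * exp (- a2 * t) - c2 * (4 * a2 * (a2 * x + a1) * exp (- 2 * a2 * t))"
proof -
  define b where "b = (\<lambda>q::point. a2 * fst q + a1)"
  define \<theta> where "\<theta> = (\<lambda>q::point. fst (snd q))"
  define h where "h = ddir e\<^sub>v E"
  note eqs = eta_v_equations[OF sym, folded h_def]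
  note [simp] = smooth_ddir point_Basis ddir_rules
  have D [simp]: "f differentiable (at p)" if "smooth_on f U" "p \<in> U" for f :: "point \<Rightarrow> real" and p
    using that by (rule smooth_differentiable)
  have [simp]: "smooth_on h U"
    using smooth_components[OF sym[unfolded point_symmetry_iff, THEN conjunct1]] by (simp add: h_def)
  have [simp]: "b differentiable (at p)" "\<theta> differentiable (at p)" for p
    by (simp_all add: b_def \<theta>_def)
  have ddir_b [simp]: "ddir e b p = a2 * fst e" and ddir_\<theta> [simp]: "ddir e \<theta> p = fst (snd e)" for e p
    by (simp_all add: b_def \<theta>_def)
  have E4: "\<forall>p\<in>U. ddir e\<^sub>t h p + a2 * h p + b p * ddir e\<^sub>x h p = 0"
    using eqs(4) by (simp add: b_def)
  have hxu: "ddir e\<^sub>u (ddir e\<^sub>x h) p = 0" and hxv: "ddir e\<^sub>v (ddir e\<^sub>x h) p = 0"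
    and hxt: "ddir e\<^sub>t (ddir e\<^sub>x h) p = - 2 * a2 * ddir e\<^sub>x h p" if "p \<in> U" for p
  proof -
    show "ddir e\<^sub>u (ddir e\<^sub>x h) p = 0" "ddir e\<^sub>v (ddir e\<^sub>x h) p = 0"
      using that ddir_zero[OF eqs(1) that, where e = "e\<^sub>x"] ddir_zero[OF eqs(2) that, where e = "e\<^sub>x"]
      by (simp_all add: ddir_commute[of h p _ "e\<^sub>x"])
    show "ddir e\<^sub>t (ddir e\<^sub>x h) p = - 2 * a2 * ddir e\<^sub>x h p"
      using ddir_zero_ball[OF E4 that, where e = "e\<^sub>x"] that eqs(3)[OF that]
      by (simp add: ddir_commute[of h p "e\<^sub>t" "e\<^sub>x"])
  qed
  obtain \<alpha> where \<alpha>: "\<And>p. p \<in> U \<Longrightarrow> ddir e\<^sub>x h p * exp (2 * a2 * \<theta> p) = \<alpha>"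
  proof (rule constant_if_ddir_zero[OF \<open>connected U\<close>, of "\<lambda>p. ddir e\<^sub>x h p * exp (2 * a2 * \<theta> p)"])
    show "ddir e (\<lambda>p. ddir e\<^sub>x h p * exp (2 * a2 * \<theta> p)) p = 0" if "p \<in> U" "e \<in> Basis" for p e
      using that hxu[OF that(1)] hxv[OF that(1)] hxt[OF that(1)] eqs(3)[OF that(1)] by auto
  qed auto
  obtain \<beta> where \<beta>: "\<And>p. p \<in> U \<Longrightarrow> (h p - b p / a2 * ddir e\<^sub>x h p) * exp (a2 * \<theta> p) = \<beta>"
  proof (rule constant_if_ddir_zero[OF \<open>connected U\<close>,
        of "\<lambda>p. (h p - b p / a2 * ddir e\<^sub>x h p) * exp (a2 * \<theta> p)"])
    show "ddir e (\<lambda>p. (h p - b p / a2 * ddir e\<^sub>x h p) * exp (a2 * \<theta> p)) p = 0"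
      if "p \<in> U" "e \<in> Basis" for p e
    proof -
      have ht: "ddir e\<^sub>t h p = - a2 * h p - b p * ddir e\<^sub>x h p"
        using E4 that by fastforce
      show ?thesis
        using that eqs(1,2,3)[OF that(1)] hxu[OF that(1)] hxv[OF that(1)] hxt[OF that(1)] \<open>a2 \<noteq> 0\<close>
        by (auto simp: ht field_simps)
    qed
  qed (use \<open>a2 \<noteq> 0\<close> in auto)
  show thesis
  proof
    fix x t u v assume p: "(x, t, u, v) \<in> U" (is "?p \<in> U")
    have hx: "ddir e\<^sub>x h ?p = \<alpha> * exp (- 2 * a2 * t)"
      using \<alpha>[OF p] by (auto simp: \<theta>_def exp_minus field_simps)
    have "h ?p = \<beta> * exp (- a2 * t) + (a2 * x + a1) / a2 * ddir e\<^sub>x h ?p"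
      using \<beta>[OF p] by (auto simp: \<theta>_def b_def exp_minus field_simps)
    also have "\<dots> = \<beta> * exp (- a2 * t)
        - (- \<alpha> / (4 * a2\<^sup>2)) * (4 * a2 * (a2 * x + a1) * exp (- 2 * a2 * t))"
      using \<open>a2 \<noteq> 0\<close> unfolding hx by (simp add: field_simps power2_eq_square)
    finally show "ddir e\<^sub>v E ?p = \<beta> * exp (- a2 * t)
        - (- \<alpha> / (4 * a2\<^sup>2)) * (4 * a2 * (a2 * x + a1) * exp (- 2 * a2 * t))"
      by (simp only: h_def)
  qed
qed

section \<open>Linearity of the space of symmetries\<close>

lemma smooth_coords:
  fixes W :: "point \<Rightarrow> point"
  assumes "smooth_on W U"
  shows "smooth_on (\<lambda>p. fst (W p)) U" "smooth_on (\<lambda>p. fst (snd (W p))) U"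
    "smooth_on (\<lambda>p. fst (snd (snd (W p)))) U" "smooth_on (\<lambda>p. snd (snd (snd (W p)))) U"
  using smooth_components[of "\<lambda>p. fst (W p)" "\<lambda>p. fst (snd (W p))" "\<lambda>p. fst (snd (snd (W p)))"
      "\<lambda>p. snd (snd (snd (W p)))"] assms by simp_all

text \<open>
  Symmetry on \<open>U\<close> only sees the values of the field on \<open>U\<close>, because partial derivatives are local
  and \<open>U\<close> is open.
\<close>

lemma prolongation_cong:
  assumes "smooth_on W U" "\<And>p. p \<in> U \<Longrightarrow> W p = W' p" "fst z \<in> U"
  shows "prolongation W z = prolongation W' z"
proof -
  have "ddir e (\<lambda>q. L (W q)) (fst z) = ddir e (\<lambda>q. L (W' q)) (fst z)"
    if "smooth_on (\<lambda>q. L (W q)) U" for e and L :: "point \<Rightarrow> real"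
    by (rule ddir_cong) (use assms that smooth_differentiable in auto)
  note this[OF smooth_coords(1)[OF assms(1)]] this[OF smooth_coords(2)[OF assms(1)]]
    this[OF smooth_coords(3)[OF assms(1)]] this[OF smooth_coords(4)[OF assms(1)]]
  then show ?thesis
    using assms(2,3) by (cases z) (simp add: prolongation_def total_x_def total_t_def pd_eq_ddir Let_def)
qed

lemma prolongation_combination:
  assumes "smooth_on W U" "smooth_on W' U" "fst z \<in> U"
  shows "prolongation (\<lambda>p. c *\<^sub>R W p + W' p) z = c *\<^sub>R prolongation W z + prolongation W' z"
proof -
  obtain p ux ut vx vt where z: "z = (p, ux, ut, vx, vt)"
    by (cases z)
  have [simp]: "(\<lambda>q. fst (W q)) differentiable (at p)" "(\<lambda>q. fst (snd (W q))) differentiable (at p)"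
    "(\<lambda>q. fst (snd (snd (W q)))) differentiable (at p)" "(\<lambda>q. snd (snd (snd (W q)))) differentiable (at p)"
    if "smooth_on W U" for W :: "point \<Rightarrow> point"
    using smooth_coords[OF that] assms(3) by (simp_all add: z smooth_differentiable)
  show ?thesis
    using assms
    by (simp add: z prolongation_def total_x_def total_t_def pd_eq_ddir Let_def ddir_rules algebra_simps)
qed

lemma point_symmetry_cong:
  assumes "point_symmetry a1 a2 U W" "\<And>p. p \<in> U \<Longrightarrow> W p = W' p"
  shows "point_symmetry a1 a2 U W'"
proof -
  have W: "smooth_on W U" using assms(1) by (simp add: point_symmetry_def)
  then show ?thesis
    using assms smooth_on_cong[OF open_U assms(2) W] prolongation_cong[OF W assms(2)]
    by (auto simp: point_symmetry_def apply_field_def)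
qed

lemma apply_field_combination:
  assumes "F differentiable (at z)" "V z = c *\<^sub>R V1 z + V2 z"
  shows "apply_field V F z = c *\<^sub>R apply_field V1 F z + apply_field V2 F z"
  using linear_frechet_derivative[OF assms(1)] assms(2)
  by (simp add: apply_field_def linear_add linear_scale)

lemma point_symmetry_combination:
  assumes "point_symmetry a1 a2 U W" "point_symmetry a1 a2 U W'"
  shows "point_symmetry a1 a2 U (\<lambda>p. c *\<^sub>R W p + W' p)"
proof -
  have W: "smooth_on W U" "smooth_on W' U" using assms by (auto simp: point_symmetry_def)
  then have "smooth_on (\<lambda>p. c *\<^sub>R W p + W' p) U"
    by (intro smooth_on_add smooth_on_linear_image[of "\<lambda>w. c *\<^sub>R w"] open_U bounded_linear_scaleR_right)
  moreover have "F differentiable (at z)" if "F = Delta1 a1 a2 \<or> F = Delta2" for F z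
    using that Delta1_has_derivative Delta2_has_derivative unfolding differentiable_def by blast
  then have "apply_field (prolongation (\<lambda>p. c *\<^sub>R W p + W' p)) F z
      = c *\<^sub>R apply_field (prolongation W) F z + apply_field (prolongation W') F z"
    if "fst z \<in> U" "F = Delta1 a1 a2 \<or> F = Delta2" for F z
    using that by (intro apply_field_combination prolongation_combination[OF W])
  ultimately show ?thesis
    using assms by (simp add: point_symmetry_def)
qed

text \<open>
  Sums and multiples are treated in one statement.  The field \<open>Z\<close> has to agree with the combination
  on \<open>U\<close> only, so that \<open>c = 0\<close> also gives invariance under changes outside \<open>U\<close>.
\<close>

lemma induced_symmetry_combination:
  assumes "induced_symmetry a1 a2 U Y" "induced_symmetry a1 a2 U Y'"
    and "\<And>p. p \<in> U \<Longrightarrow> Z p = c *\<^sub>R Y p + Y' p"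
  shows "induced_symmetry a1 a2 U Z"
proof -
  obtain \<phi> \<phi>' where
    "point_symmetry a1 a2 U (\<lambda>p. (fst (Y p), fst (snd (Y p)), snd (snd (Y p)), \<phi> p))"
    "point_symmetry a1 a2 U (\<lambda>p. (fst (Y' p), fst (snd (Y' p)), snd (snd (Y' p)), \<phi>' p))"
    using assms(1,2) unfolding induced_symmetry_def by blast
  from point_symmetry_combination[OF this, of c]
  have "point_symmetry a1 a2 U (\<lambda>p. (fst (Z p), fst (snd (Z p)), snd (snd (Z p)), c * \<phi> p + \<phi>' p))"
    by (rule point_symmetry_cong) (simp add: assms(3))
  then show ?thesis unfolding induced_symmetry_def by (intro exI[of _ "\<lambda>p. c * \<phi> p + \<phi>' p"])
qed

section \<open>The two generators\<close>

lemmas smooth_intros = smooth_on_Pair[OF open_U] smooth_on_add[OF open_U] smooth_on_mult[OF open_U]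
  smooth_on_exp[OF open_U] smooth_on_const
  smooth_on_linear[of "\<lambda>q. fst q"] smooth_on_linear[of "\<lambda>q. fst (snd q)"]
  smooth_on_linear[of "\<lambda>q. fst (snd (snd q))"] smooth_on_linear[of "\<lambda>q. snd (snd (snd q))"]
  bounded_linear_fst bounded_linear_fst_comp bounded_linear_snd_comp bounded_linear_ident

text \<open>
  The required \<open>\<phi>\<close> is linear in \<open>v\<close> with slope \<open>f\<close> satisfying \<open>f\<^sub>x = \<eta>\<^sub>v = exp (- a2 t)\<close> and the
  evolution equation \<open>f\<^sub>t + b f\<^sub>x = f\<^sub>x\<^sub>x / 2\<close>.  The latter makes the part of \<open>f\<close> that is free of
  \<open>x\<close> equal to \<open>a1 / a2 exp (- a2 t)\<close> up to a constant, and the constant is zero because the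
  coefficient of \<open>u\<close> in \<open>\<eta>\<close> is \<open>f - \<xi>\<^sub>x\<close>.
\<close>

lemma induced_symmetry_Y1:
  assumes "a2 \<noteq> 0"
  shows "induced_symmetry a1 a2 U (Y1 a1 a2)"
  unfolding induced_symmetry_def
proof
  let ?e = "\<lambda>q::point. exp (- a2 * fst (snd q))"
  let ?x = "\<lambda>q::point. fst q" and ?u = "\<lambda>q::point. fst (snd (snd q))"
    and ?v = "\<lambda>q::point. snd (snd (snd q))"
  let ?P = "\<lambda>q. (?x q + a1 / a2) * ?v q * ?e q"
  have "point_symmetry a1 a2 U (\<lambda>q. (1 / (2 * a2) * ?e q, 0, ((?x q + a1 / a2) * ?u q + ?v q) * ?e q, ?P q))"
    unfolding point_symmetry_iff
  proof (intro conjI)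
    show "smooth_on (\<lambda>q. (1 / (2 * a2) * ?e q, 0, ((?x q + a1 / a2) * ?u q + ?v q) * ?e q, ?P q)) U"
      by (intro smooth_intros)
  qed (use assms in \<open>simp add: ddir_rules Let_def field_simps\<close>)
  then show "point_symmetry a1 a2 U (\<lambda>p. (fst (Y1 a1 a2 p), fst (snd (Y1 a1 a2 p)), snd (snd (Y1 a1 a2 p)), ?P p))"
    by (simp add: Y1_def case_prod_beta)
qed

text \<open>
  Here \<open>f\<^sub>x = - 4 a2 b exp (- 2 a2 t)\<close>, and the antiderivative \<open>- 2 b\<^sup>2 exp (- 2 a2 t)\<close>
  needs the correction \<open>a2 exp (- 2 a2 t)\<close>, free of \<open>x\<close>, to satisfy the same evolution equation.
\<close>

lemma induced_symmetry_Y2: "induced_symmetry a1 a2 U (Y2 a1 a2)"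
  unfolding induced_symmetry_def
proof
  let ?e = "\<lambda>q::point. exp (- 2 * a2 * fst (snd q))"
  let ?b = "\<lambda>q::point. a2 * fst q + a1" and ?u = "\<lambda>q::point. fst (snd (snd q))"
    and ?v = "\<lambda>q::point. snd (snd (snd q))"
  let ?P = "\<lambda>q. (a2 + (- 2) * (?b q * ?b q)) * ?v q * ?e q"
  let ?E = "\<lambda>q. - 2 * ((?b q * ?b q + (- a2)) * ?u q + 2 * a2 * ?b q * ?v q) * ?e q"
  have "point_symmetry a1 a2 U (\<lambda>q. ((- 1) * ?b q * ?e q, ?e q, ?E q, ?P q))"
    unfolding point_symmetry_iff
  proof (intro conjI)
    show "smooth_on (\<lambda>q. ((- 1) * ?b q * ?e q, ?e q, ?E q, ?P q)) U"
      by (intro smooth_intros)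
  qed (simp add: ddir_rules Let_def field_simps)
  then show "point_symmetry a1 a2 U (\<lambda>p. (fst (Y2 a1 a2 p), fst (snd (Y2 a1 a2 p)), snd (snd (Y2 a1 a2 p)), ?P p))"
    by (simp add: Y2_def case_prod_beta power2_eq_square)
qed

lemma eta_v_Y1: "pd_v (\<lambda>q. snd (snd (Y1 a1 a2 q))) (x, t, u, v) = exp (- a2 * t)"
  unfolding Y1_def case_prod_beta pd_eq_ddir by (simp add: ddir_rules)

lemma eta_v_Y2:
  "pd_v (\<lambda>q. snd (snd (Y2 a1 a2 q))) (x, t, u, v) = - (4 * a2 * (a2 * x + a1) * exp (- 2 * a2 * t))"
  unfolding Y2_def case_prod_beta pd_eq_ddir power2_eq_square by (simp add: ddir_rules)

lemma induced_symmetry_differentiable: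
  assumes "induced_symmetry a1 a2 U Y" "p \<in> U"
  shows "(\<lambda>q. snd (snd (Y q))) differentiable (at p)"
proof -
  obtain P where "point_symmetry a1 a2 U (\<lambda>p. (fst (Y p), fst (snd (Y p)), snd (snd (Y p)), P p))"
    using assms(1) unfolding induced_symmetry_def by blast
  then have "smooth_on (\<lambda>q. snd (snd (Y q))) U"
    unfolding point_symmetry_def by (elim conjE) (rule smooth_components(3))
  then show ?thesis
    using assms(2) by (rule smooth_differentiable)
qed

lemma eta_v_combination:
  assumes "induced_symmetry a1 a2 U Y" "induced_symmetry a1 a2 U Y'" "induced_symmetry a1 a2 U Z"
    and "\<And>p. p \<in> U \<Longrightarrow> Z p = c *\<^sub>R Y p + Y' p" and "p \<in> U"
  shows "pd_v (\<lambda>q. snd (snd (Z q))) p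
    = c * pd_v (\<lambda>q. snd (snd (Y q))) p + pd_v (\<lambda>q. snd (snd (Y' q))) p"
proof -
  note diff = induced_symmetry_differentiable[OF _ \<open>p \<in> U\<close>]
  have "pd_v (\<lambda>q. snd (snd (Z q))) p = ddir e\<^sub>v (\<lambda>q. c * snd (snd (Y q)) + snd (snd (Y' q))) p"
    unfolding pd_eq_ddir by (rule ddir_cong) (use assms diff in auto)
  then show ?thesis
    using diff[OF assms(1)] diff[OF assms(2)] by (simp add: pd_eq_ddir ddir_rules)
qed

text \<open>
  The determining equations \<open>\<tau>\<^sub>v = \<xi>\<^sub>v = 0\<close> remove two of the three squares.
\<close>

lemma depends_on_v_iff:
  assumes "induced_symmetry a1 a2 U Y"
  shows "depends_on_v U Y \<longleftrightarrow> (\<exists>p\<in>U. pd_v (\<lambda>q. snd (snd (Y q))) p \<noteq> 0)"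
proof -
  obtain P where "point_symmetry a1 a2 U (\<lambda>p. (fst (Y p), fst (snd (Y p)), snd (snd (Y p)), P p))"
    using assms unfolding induced_symmetry_def by blast
  from determining_equations(3,5)[OF this] show ?thesis
    by (simp add: depends_on_v_def pd_eq_ddir)
qed

text \<open>
  A derivative in \<open>x\<close> removes the first term and leaves a nonzero multiple of \<open>c2\<close>.
\<close>

lemma Y1_Y2_independent:
  assumes "a2 \<noteq> 0" "U \<noteq> {}"
    and f: "\<forall>q\<in>U. c1 * exp (- a2 * fst (snd q))
      - c2 * (4 * a2 * (a2 * fst q + a1) * exp (- 2 * a2 * fst (snd q))) = 0"
  shows "c1 = 0" "c2 = 0"
proof -
  obtain p where p: "p \<in> U" using assms(2) by blast
  from ddir_zero_ball[OF f p, of "e\<^sub>x"] show "c2 = 0"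
    using \<open>a2 \<noteq> 0\<close> by (simp add: ddir_rules)
  with f[rule_format, OF p] show "c1 = 0" by simp
qed

end

section \<open>Potential symmetries\<close>

theorem proposition3p3:
  fixes a1 a2 :: real and U :: "point set"
  assumes "a2 \<noteq> 0"
    and "open U" and "connected U" and "U \<noteq> {}"
  shows "potential_symmetry a1 a2 U (Y1 a1 a2) \<and>
         potential_symmetry a1 a2 U (Y2 a1 a2) \<and>
         (\<forall>Y. potential_symmetry a1 a2 U Y \<longleftrightarrow>
            (\<exists>c1 c2 Y0. (c1 \<noteq> 0 \<or> c2 \<noteq> 0) \<and> nonpotential_symmetry a1 a2 U Y0 \<and>
               (\<forall>p\<in>U. Y p = c1 *\<^sub>R Y1 a1 a2 p + c2 *\<^sub>R Y2 a1 a2 p + Y0 p)))"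
proof -
  interpret open_domain U by standard (rule \<open>open U\<close>)
  let ?h = "\<lambda>(Y::yfield) p. pd_v (\<lambda>q. snd (snd (Y q))) p"
  let ?Y1 = "Y1 a1 a2" and ?Y2 = "Y2 a1 a2"
  have ind1: "induced_symmetry a1 a2 U ?Y1" and ind2: "induced_symmetry a1 a2 U ?Y2"
    using induced_symmetry_Y1[OF \<open>a2 \<noteq> 0\<close>] induced_symmetry_Y2 by auto
  have indep: "\<exists>p\<in>U. c1 * ?h ?Y1 p + c2 * ?h ?Y2 p \<noteq> 0" if "c1 \<noteq> 0 \<or> c2 \<noteq> 0" for c1 c2
  proof (rule ccontr)
    assume "\<not> ?thesis"
    then have "\<forall>q\<in>U. c1 * exp (- a2 * fst (snd q))
      - c2 * (4 * a2 * (a2 * fst q + a1) * exp (- 2 * a2 * fst (snd q))) = 0"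
      by (auto simp: eta_v_Y1 eta_v_Y2)
    from Y1_Y2_independent[OF assms(1,4) this] that show False by blast
  qed
  \<comment> \<open>The field \<open>Y0\<close> is an arbitrary induced symmetry, so that this serves to add
    the generators and to subtract them.\<close>
  have split: "induced_symmetry a1 a2 U (\<lambda>p. c1 *\<^sub>R ?Y1 p + c2 *\<^sub>R ?Y2 p + Y0 p)
      \<and> (\<forall>p\<in>U. ?h (\<lambda>p. c1 *\<^sub>R ?Y1 p + c2 *\<^sub>R ?Y2 p + Y0 p) p = c1 * ?h ?Y1 p + c2 * ?h ?Y2 p + ?h Y0 p)"
    if "induced_symmetry a1 a2 U Y0" for c1 c2 Y0
  proof -
    let ?Z = "\<lambda>p. c2 *\<^sub>R ?Y2 p + Y0 p" and ?W = "\<lambda>p. c1 *\<^sub>R ?Y1 p + c2 *\<^sub>R ?Y2 p + Y0 p"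
    have Z: "induced_symmetry a1 a2 U ?Z"
      by (rule induced_symmetry_combination[OF ind2 that, where c = c2]) simp
    have W: "induced_symmetry a1 a2 U ?W"
      by (rule induced_symmetry_combination[OF ind1 Z, where c = c1]) (simp add: add.assoc)
    have "?h ?W p = c1 * ?h ?Y1 p + ?h ?Z p" "?h ?Z p = c2 * ?h ?Y2 p + ?h Y0 p" if "p \<in> U" for p
      using eta_v_combination[OF ind1 Z W, of c1 p]
        eta_v_combination[OF ind2 \<open>induced_symmetry a1 a2 U Y0\<close> Z, of c2 p] that
      by (simp_all add: add.assoc)
    then show ?thesis using W by simp
  qed
  have "potential_symmetry a1 a2 U ?Y1"
    using indep[of 1 0] ind1 by (simp add: potential_symmetry_def depends_on_v_iff)
  moreover have "potential_symmetry a1 a2 U ?Y2"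
    using indep[of 0 1] ind2 by (simp add: potential_symmetry_def depends_on_v_iff)
  moreover have "potential_symmetry a1 a2 U Y \<longleftrightarrow>
            (\<exists>c1 c2 Y0. (c1 \<noteq> 0 \<or> c2 \<noteq> 0) \<and> nonpotential_symmetry a1 a2 U Y0 \<and>
               (\<forall>p\<in>U. Y p = c1 *\<^sub>R ?Y1 p + c2 *\<^sub>R ?Y2 p + Y0 p))" (is "?L \<longleftrightarrow> ?R") for Y
  proof
    assume ?L
    then have Y: "induced_symmetry a1 a2 U Y" and dep: "\<exists>p\<in>U. ?h Y p \<noteq> 0"
      by (auto simp: potential_symmetry_def depends_on_v_iff)
    then obtain P where P: "point_symmetry a1 a2 U (\<lambda>p. (fst (Y p), fst (snd (Y p)), snd (snd (Y p)), P p))"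
      unfolding induced_symmetry_def by blast
    obtain c1 c2 where c: "\<And>x t u v. (x, t, u, v) \<in> U \<Longrightarrow> ?h Y (x, t, u, v)
        = c1 * exp (- a2 * t) - c2 * (4 * a2 * (a2 * x + a1) * exp (- 2 * a2 * t))"
      using eta_v_form[OF assms(1,3) P] unfolding pd_eq_ddir by blast
    have hY: "?h Y p = c1 * ?h ?Y1 p + c2 * ?h ?Y2 p" if "p \<in> U" for p
      using that c by (cases p) (simp add: eta_v_Y1 eta_v_Y2)
    define Y0 where "Y0 = (\<lambda>p. (- c1) *\<^sub>R ?Y1 p + (- c2) *\<^sub>R ?Y2 p + Y p)"
    have "induced_symmetry a1 a2 U Y0
        \<and> (\<forall>p\<in>U. ?h Y0 p = (- c1) * ?h ?Y1 p + (- c2) * ?h ?Y2 p + ?h Y p)"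
      unfolding Y0_def by (rule split[OF Y])
    then have "nonpotential_symmetry a1 a2 U Y0"
      using hY by (auto simp: nonpotential_symmetry_def depends_on_v_iff)
    moreover have "c1 \<noteq> 0 \<or> c2 \<noteq> 0"
      using dep hY by auto
    ultimately show ?R
      by (intro exI[of _ c1] exI[of _ c2] exI[of _ Y0]) (simp add: Y0_def)
  next
    assume ?R
    then obtain c1 c2 Y0 where c: "c1 \<noteq> 0 \<or> c2 \<noteq> 0" and Y0: "nonpotential_symmetry a1 a2 U Y0"
      and Y: "\<And>p. p \<in> U \<Longrightarrow> Y p = c1 *\<^sub>R ?Y1 p + c2 *\<^sub>R ?Y2 p + Y0 p"
      by blast
    then have ind0: "induced_symmetry a1 a2 U Y0" and h0: "\<forall>p\<in>U. ?h Y0 p = 0"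
      by (auto simp: nonpotential_symmetry_def depends_on_v_iff)
    let ?W = "\<lambda>p. c1 *\<^sub>R ?Y1 p + c2 *\<^sub>R ?Y2 p + Y0 p"
    have W: "induced_symmetry a1 a2 U ?W"
      using split[OF ind0] by blast
    have indY: "induced_symmetry a1 a2 U Y"
      by (rule induced_symmetry_combination[OF W W, where c = 0]) (simp add: Y)
    have "?h Y p = c1 * ?h ?Y1 p + c2 * ?h ?Y2 p" if "p \<in> U" for p
      using eta_v_combination[OF W W indY, of 0 p] split[OF ind0, of c1 c2] h0 that by (simp add: Y)
    with indep[OF c] have "\<exists>p\<in>U. ?h Y p \<noteq> 0" by auto
    then show ?L
      using indY by (simp add: potential_symmetry_def depends_on_v_iff)
  qed
  ultimately show ?thesis by blast
qed

end
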